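(* Let $F_0$ be a fixed graph and let $k\ge 2$ and $r$ be fixed integers with $m=\chi(F_0)>r>k$. Then, as $n\to\infty$, $$\mathrm{ex}_k(n,\mathcal{K}_r^{(k)},F_0^{+k})=(1+o(1))\,|E(T^r(n,m-1))|.$$
   Context: $\chi(F_0)$ is the chromatic number. The expansion $F_0^{+k}$ is the $k$-uniform hypergraph obtained from $F_0$ by adding $k-2$ new vertices to each edge of $F_0$, the new vertices being distinct for distinct edges. $\mathcal{K}_r^{(k)}$ is the complete $k$-uniform hypergraph on $r$ vertices. For $k$-uniform $\mathcal{F}$, $\mathrm{ex}_k(n,\mathcal{K}_r^{(k)},\mathcal{F})$ is the maximum number of subhypergraphs isomorphic to $\mathcal{K}_r^{(k)}$ in a $k$-uniform hypergraph on $n$ vertices having no subhypergraph isomorphic to $\mathcal{F}$. The Turán hypergraph $T^r(n,m-1)$ is the $r$-uniform hypergraph on an $n$-element vertex set partitioned into $m-1$ parts whose sizes differ pairwise by at most $1$, whose hyperedges are all $r$-sets meeting every part in at most one vertex. *)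

theory Defs
  imports Complex_Main "HOL-Library.Disjoint_Sets" "HOL-Library.Landau_Symbols"
begin

datatype 'a hypergraph = Hypergraph (verts: "'a set") (edges: "'a set set")

definition hypergraph :: "'a hypergraph \<Rightarrow> bool" where
  "hypergraph H \<longleftrightarrow> finite (verts H) \<and> (\<forall>e\<in>edges H. e \<subseteq> verts H)"

definition uniform_hypergraph :: "nat \<Rightarrow> 'a hypergraph \<Rightarrow> bool" where
  "uniform_hypergraph k H \<longleftrightarrow> hypergraph H \<and> (\<forall>e\<in>edges H. card e = k)"

text \<open>Finite simple graphs are exactly the 2-uniform hypergraphs.\<close>

abbreviation simple_graph :: "'a hypergraph \<Rightarrow> bool" where
  "simple_graph G \<equiv> uniform_hypergraph 2 G"

definition subhypergraph :: "'a hypergraph \<Rightarrow> 'a hypergraph \<Rightarrow> bool" where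
  "subhypergraph S H \<longleftrightarrow> hypergraph S \<and> verts S \<subseteq> verts H \<and> edges S \<subseteq> edges H"

definition isomorphic :: "'a hypergraph \<Rightarrow> 'b hypergraph \<Rightarrow> bool" where
  "isomorphic G H \<longleftrightarrow>
     (\<exists>f. bij_betw f (verts G) (verts H) \<and> (\<lambda>e. f ` e) ` edges G = edges H)"

definition copies :: "'a hypergraph \<Rightarrow> 'b hypergraph \<Rightarrow> 'a hypergraph set" where
  "copies H K = {S. subhypergraph S H \<and> isomorphic S K}"

definition complete_hypergraph :: "nat \<Rightarrow> nat \<Rightarrow> nat hypergraph" where
  "complete_hypergraph k r = Hypergraph {..<r} {e. e \<subseteq> {..<r} \<and> card e = k}"

definition proper_coloring :: "'a hypergraph \<Rightarrow> nat \<Rightarrow> ('a \<Rightarrow> nat) \<Rightarrow> bool" where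
  "proper_coloring G c f \<longleftrightarrow>
     f ` verts G \<subseteq> {..<c} \<and> (\<forall>u v. {u, v} \<in> edges G \<longrightarrow> f u \<noteq> f v)"

definition chromatic_number :: "'a hypergraph \<Rightarrow> nat" where
  "chromatic_number G = (LEAST c. \<exists>f. proper_coloring G c f)"

text \<open>\<open>Inl v\<close> is an original vertex; \<open>Inr (e, i)\<close> with \<open>i < k - 2\<close> are the new vertices
  of the edge \<open>e\<close>. The truncated subtraction is harmless since \<open>k \<ge> 2\<close> in all uses.\<close>

definition expansion_edge :: "nat \<Rightarrow> 'a set \<Rightarrow> ('a + 'a set \<times> nat) set" where
  "expansion_edge k e = Inl ` e \<union> Inr ` ({e} \<times> {..<k - 2})"

definition expansion :: "nat \<Rightarrow> 'a hypergraph \<Rightarrow> ('a + 'a set \<times> nat) hypergraph" where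
  "expansion k G =
     Hypergraph (Inl ` verts G \<union> Inr ` (edges G \<times> {..<k - 2})) (expansion_edge k ` edges G)"

text \<open>Up to isomorphism every hypergraph on \<open>n\<close> vertices has vertex set \<open>{..<n}\<close>, so the
  maximum is over a finite set; it is nonempty as soon as \<open>F\<close> has an edge.\<close>

definition ex :: "nat \<Rightarrow> nat \<Rightarrow> 'a hypergraph \<Rightarrow> 'b hypergraph \<Rightarrow> nat" where
  "ex k n K F =
     Max {card (copies H K) | H :: nat hypergraph.
            uniform_hypergraph k H \<and> verts H = {..<n} \<and> copies H F = {}}"

text \<open>The balanced partition of \<open>{..<n}\<close> into \<open>p\<close> parts is by residues modulo \<open>p\<close>.
  When \<open>n < p\<close> some parts are empty.\<close>

definition turan_part :: "nat \<Rightarrow> nat \<Rightarrow> nat \<Rightarrow> nat set" where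
  "turan_part n p i = {v. v < n \<and> v mod p = i}"

definition turan_hypergraph :: "nat \<Rightarrow> nat \<Rightarrow> nat \<Rightarrow> nat hypergraph" where
  "turan_hypergraph r n p =
     Hypergraph {..<n}
       {e. e \<subseteq> {..<n} \<and> card e = r \<and> (\<forall>i<p. card (e \<inter> turan_part n p i) \<le> 1)}"

lemma turan_parts_cover: "p > 0 \<Longrightarrow> (\<Union>i<p. turan_part n p i) = {..<n}"
  by (auto simp: turan_part_def)

lemma turan_parts_disjoint: "disjoint_family_on (turan_part n p) {..<p}"
  by (auto simp: turan_part_def disjoint_family_on_def)

lemma turan_parts_balanced:
  assumes "i < p" "j < p"
  shows "card (turan_part n p i) \<le> card (turan_part n p j) + 1"
proof -
  have fin: "finite (turan_part n p l)" for l
    by (simp add: turan_part_def)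
  have "turan_part n p i - {i} \<subseteq> (\<lambda>w. w + p + i - j) ` turan_part n p j"
  proof
    fix v assume v: "v \<in> turan_part n p i - {i}"
    then have vn: "v < n" and vi: "v mod p = i" "v \<noteq> i"
      by (auto simp: turan_part_def)
    define q where "q = v div p"
    have veq: "v = q * p + i"
      using vi by (simp add: q_def mult.commute flip: vi(1))
    with vi(2) obtain q' where q': "q = Suc q'"
      by (cases q) auto
    let ?w = "q' * p + j"
    have "?w < n" "?w mod p = j" "v = ?w + p + i - j"
      using veq q' vn assms by auto
    then show "v \<in> (\<lambda>w. w + p + i - j) ` turan_part n p j"
      by (auto simp: turan_part_def intro!: image_eqI[of _ _ ?w])
  qed
  then have "card (turan_part n p i - {i}) \<le> card (turan_part n p j)"
    by (rule surj_card_le[OF fin])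
  moreover have "card (turan_part n p i) \<le> card (turan_part n p i - {i}) + 1"
    by (cases "i \<in> turan_part n p i") (auto simp: fin card_Diff_singleton)
  ultimately show ?thesis by linarith
qed

end

theory Submission
  imports Defs "HOL-Library.FuncSet"
begin

text \<open>
  Write \<open>p = m - 1\<close>, so that \<open>F\<^sub>0\<close> has a proper colouring with \<open>p + 1\<close> colours and none with \<open>p\<close>.

  The lower bound holds for every \<open>n\<close>. The \<open>k\<close>-uniform Turan hypergraph with \<open>p\<close> parts contains no
  copy of the expansion, because the parts met by the original vertices of a copy would properly
  colour \<open>F\<^sub>0\<close> with \<open>p\<close> colours (\<open>turan_hypergraph_expansion_free\<close>). Each hyperedge of
  \<open>T\<^sup>r(n, p)\<close> spans a complete \<open>k\<close>-uniform hypergraph in it (\<open>turan_edges_are_cliques\<close>).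

  For the upper bound, call an \<open>r\<close>-set a clique of \<open>H\<close> if all its \<open>k\<close>-subsets are hyperedges of \<open>H\<close>,
  and join two vertices if some clique contains both. Suppose that this graph, on a vertex set of
  size \<open>N\<close>, has no \<open>p + 1\<close> pairwise adjacent vertices. By Zykov's theorem (\<open>zykov_clique_bound\<close>)
  the number of cliques is then at most \<open>(p choose r) (N / p)\<^sup>r\<close>. So if \<open>H\<close> has more cliques than
  that, there are \<open>p + 1\<close> vertices any two of which lie in a common clique. Sending each colour
  class of \<open>F\<^sub>0\<close> to one of these vertices maps every edge of \<open>F\<^sub>0\<close> into a clique, and as \<open>r \<ge> k\<close> the
  clique has room for the \<open>k - 2\<close> new vertices of that edge (\<open>expansion_hom_into_dense\<close>). The result
  is a map from the expansion to \<open>H\<close> that is injective on each hyperedge, though it may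
  identify vertices of different hyperedges.

  To remove the identifications, such maps are found in abundance. If \<open>H\<close> on \<open>n\<close> vertices has
  \<open>(1 + \<epsilon>) (p choose r) (n / p)\<^sup>r\<close> cliques, averaging over the \<open>N\<close>-subsets of its vertex set, for
  a constant \<open>N\<close> depending on \<open>\<epsilon>\<close>, shows that a positive proportion of them contain more than
  \<open>(p choose r) (N / p)\<^sup>r\<close> cliques (\<open>sample_clique_sets\<close>) and hence the image of such a map. By
  pigeonhole a positive proportion of the \<open>N\<close>-subsets, written as increasing lists, carry the
  same map. Erdos's theorem on dense \<open>N\<close>-partite systems (\<open>box_theorem\<close>) then produces an arbitrarily
  large blow-up of one image in \<open>H\<close>, and in a blow-up the vertices can be separated
  (\<open>blow_up_contains\<close>), so \<open>H\<close> contains the expansion.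

  Finally \<open>T\<^sup>r(n, p)\<close> has at least \<open>(p choose r) \<lfloor>n / p\<rfloor>\<^sup>r\<close> hyperedges, which is asymptotic to
  \<open>(p choose r) (n / p)\<^sup>r\<close>, so the two bounds agree up to a factor \<open>1 + o(1)\<close>.
\<close>

section \<open>Zykov's bound on the number of cliques\<close>

text \<open>
  Bernoulli's inequality, cleared of denominators so that \<open>u = 0\<close> is included: the tangent to the
  convex function \<open>y ^ Suc r\<close> at \<open>u\<close> lies below its graph.
\<close>

lemma tangent_power_le:
  fixes u z :: real
  assumes "0 \<le> u" "0 \<le> u + z"
  shows "u ^ Suc r + real (Suc r) * u ^ r * z \<le> (u + z) ^ Suc r"
proof (cases "u = 0")
  case True
  then show ?thesis using assms by (cases r) auto
next
  case False
  then have u: "u > 0" using assms by simp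
  let ?B = "(1 + z / u) ^ Suc r"
  have "1 + real (Suc r) * (z / u) \<le> ?B"
    using u assms by (intro Bernoulli_inequality) (simp add: field_simps)
  then have "u ^ Suc r * (1 + real (Suc r) * (z / u)) \<le> u ^ Suc r * ?B"
    using u by (intro mult_left_mono) auto
  also have "\<dots> = (u * (1 + z / u)) ^ Suc r" by (simp only: power_mult_distrib)
  also have "u * (1 + z / u) = u + z" using u by (simp add: field_simps)
  also have "u ^ Suc r * (1 + real (Suc r) * (z / u)) = u ^ Suc r + real (Suc r) * u ^ r * z"
    using u by (simp add: field_simps)
  finally show ?thesis .
qed

text \<open>
  The left side counts the \<open>Suc r\<close>-sets that are transversal to \<open>q\<close> parts of size \<open>u\<close> and one part of
  size \<open>x\<close>; making all \<open>q + 1\<close> parts equal does not decrease this count. Moving to the mean changes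
  the common size by \<open>z\<close>, and the left side is the value there of the tangent at \<open>u\<close> to the right side.
\<close>

lemma binomial_balance_le:
  fixes u x :: real
  assumes "0 \<le> u" "0 \<le> x"
  shows "real (q choose Suc r) * u ^ Suc r + x * (real (q choose r) * u ^ r)
         \<le> real (Suc q choose Suc r) * ((x + real q * u) / real (Suc q)) ^ Suc r"
proof -
  define z where "z = (x - u) / real (Suc q)"
  have uz: "u + z = (x + real q * u) / real (Suc q)"
    by (simp add: z_def field_simps)
  let ?c = "real (Suc q choose Suc r)"
  have b1: "real (Suc q) * real (q choose r) = ?c * real (Suc r)"
    using Suc_times_binomial_eq[of q r] by (metis of_nat_mult)
  have b2: "?c = real (q choose r) + real (q choose Suc r)" by simp
  have x: "x = u + real (Suc q) * z" by (simp add: z_def)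
  have "real (q choose Suc r) * u ^ Suc r + x * (real (q choose r) * u ^ r)
      = ?c * u ^ Suc r + (real (Suc q) * real (q choose r)) * (u ^ r * z)"
    unfolding b2 x by (simp add: algebra_simps)
  also have "\<dots> = ?c * (u ^ Suc r + real (Suc r) * u ^ r * z)"
    unfolding b1 by (simp add: algebra_simps)
  also have "\<dots> \<le> ?c * (u + z) ^ Suc r"
    by (intro mult_left_mono tangent_power_le)
      (use assms in \<open>auto simp: uz intro!: divide_nonneg_pos add_nonneg_nonneg mult_nonneg_nonneg\<close>)
  finally show ?thesis by (simp only: uz)
qed

definition clique :: "('v \<Rightarrow> 'v \<Rightarrow> bool) \<Rightarrow> 'v set \<Rightarrow> bool" where
  "clique adj A \<longleftrightarrow> (\<forall>x\<in>A. \<forall>y\<in>A. x \<noteq> y \<longrightarrow> adj x y)"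

definition cliques :: "('v \<Rightarrow> 'v \<Rightarrow> bool) \<Rightarrow> nat \<Rightarrow> 'v set \<Rightarrow> 'v set set" where
  "cliques adj r V = {A. A \<subseteq> V \<and> card A = r \<and> clique adj A}"

lemma finite_cliques: "finite V \<Longrightarrow> finite (cliques adj r V)"
  by (rule finite_subset[of _ "Pow V"]) (auto simp: cliques_def)

text \<open>
  Choose a vertex \<open>v\<close> whose neighbourhood contains the most cliques of size \<open>r - 1\<close>. An \<open>r\<close>-clique lies
  in the neighbourhood of \<open>v\<close> or has a vertex \<open>w\<close> outside it, and then the rest of it is a
  clique of size \<open>r - 1\<close> in the neighbourhood of \<open>w\<close>, of which there are no more than for \<open>v\<close>.
  Since \<open>v\<close> extends every clique in its neighbourhood, the latter contains no clique on \<open>p\<close> vertices,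
  so induction on \<open>p\<close> bounds both numbers. The bound obtained is the count for equal parts filling
  the neighbourhood and one further part outside it, which balancing only increases.

  For \<open>p = 0\<close> the quotient is \<open>0 / 0 = 0\<close>, and the bound is \<open>1\<close> or \<open>0\<close> as it should be.
\<close>

theorem zykov_clique_bound:
  assumes sym: "\<And>x y. adj x y \<Longrightarrow> adj y x" and irrefl: "\<And>x. \<not> adj x x"
    and "finite V" "cliques adj (Suc p) V = {}"
  shows "real (card (cliques adj r V)) \<le> real (p choose r) * (real (card V) / real p) ^ r"
  using assms(3-)
proof (induction p arbitrary: V r)
  case 0
  have "V = {}"
  proof (rule ccontr)
    assume "V \<noteq> {}"
    then obtain v where "v \<in> V" by blast
    then have "{v} \<in> cliques adj (Suc 0) V" by (auto simp: cliques_def clique_def)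
    with 0 show False by simp
  qed
  then have "cliques adj r V = (if r = 0 then {{}} else {})"
    by (auto simp: cliques_def clique_def)
  then show ?case by simp
next
  case (Suc p)
  note fin = \<open>finite V\<close>
  show ?case
  proof (cases "r = 0 \<or> V = {}")
    case True
    moreover have "card (cliques adj 0 V) = 1"
    proof -
      have "cliques adj 0 V = {{}}"
        using fin by (auto simp: cliques_def clique_def dest: rev_finite_subset)
      then show ?thesis by simp
    qed
    moreover have "cliques adj r {} = {}" if "r \<noteq> 0" using that by (auto simp: cliques_def)
    ultimately show ?thesis by (cases "r = 0") simp_all
  next
    case False
    then obtain s where r: "r = Suc s" by (cases r) auto
    define nb where "nb v = {w \<in> V. adj v w}" for v
    have nb: "nb v \<subseteq> V" "finite (nb v)" for v
      using fin by (auto simp: nb_def)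
    define d where "d v = card (cliques adj s (nb v))" for v
    have "Max (d ` V) \<in> d ` V" using fin False by (intro Max_in) auto
    then obtain v where v: "v \<in> V" and "d v = Max (d ` V)" by force
    then have vmax: "d w \<le> d v" if "w \<in> V" for w using fin that by simp
    have free: "cliques adj (Suc p) (nb v) = {}"
    proof (rule ccontr)
      assume "cliques adj (Suc p) (nb v) \<noteq> {}"
      then obtain A where A: "A \<in> cliques adj (Suc p) (nb v)" by blast
      then have sub: "A \<subseteq> nb v" and card: "card A = Suc p" and "clique adj A"
        by (auto simp: cliques_def)
      have "v \<notin> nb v" using irrefl by (simp add: nb_def)
      with sub have "v \<notin> A" by blast
      moreover have "finite A" using sub nb(2) by (rule finite_subset)
      moreover have "\<forall>w\<in>A. adj v w \<and> adj w v" using sub sym by (force simp: nb_def)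
      ultimately have "insert v A \<in> cliques adj (Suc (Suc p)) V"
        using \<open>clique adj A\<close> card sub nb(1)[of v] v by (auto simp: cliques_def clique_def)
      with Suc.prems(2) show False by blast
    qed
    have cover: "cliques adj r V
        \<subseteq> cliques adj r (nb v) \<union> (\<Union>w\<in>V - nb v. insert w ` cliques adj s (nb w))"
    proof
      fix A assume A: "A \<in> cliques adj r V"
      show "A \<in> cliques adj r (nb v) \<union> (\<Union>w\<in>V - nb v. insert w ` cliques adj s (nb w))"
      proof (cases "A \<subseteq> nb v")
        case True
        with A show ?thesis by (auto simp: cliques_def)
      next
        case False
        then obtain w where w: "w \<in> A" "w \<notin> nb v" by blast
        then have "A - {w} \<in> cliques adj s (nb w)"
          using A r by (auto simp: cliques_def clique_def nb_def)
        moreover have "A = insert w (A - {w})" using w by blast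
        ultimately have "A \<in> insert w ` cliques adj s (nb w)" by (rule rev_image_eqI)
        moreover have "w \<in> V - nb v" using w A by (auto simp: cliques_def)
        ultimately show ?thesis by blast
      qed
    qed
    have "card (cliques adj r V)
        \<le> card (cliques adj r (nb v)) + card (\<Union>w\<in>V - nb v. insert w ` cliques adj s (nb w))"
      by (rule order_trans[OF card_mono[OF _ cover] card_Un_le])
        (auto intro!: finite_cliques simp: fin nb)
    also have "card (\<Union>w\<in>V - nb v. insert w ` cliques adj s (nb w))
        \<le> (\<Sum>w\<in>V - nb v. card (insert w ` cliques adj s (nb w)))"
      using fin by (intro card_UN_le) auto
    also have "\<dots> \<le> (\<Sum>w\<in>V - nb v. d v)"
    proof (rule sum_mono)
      fix w assume "w \<in> V - nb v"
      then show "card (insert w ` cliques adj s (nb w)) \<le> d v"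
        using card_image_le[OF finite_cliques[OF nb(2)], of "insert w" adj s w] vmax[of w]
        by (simp add: d_def)
    qed
    finally have "card (cliques adj r V) \<le> card (cliques adj r (nb v)) + card (V - nb v) * d v"
      by simp
    then have "real (card (cliques adj r V))
        \<le> real (card (cliques adj r (nb v))) + real (card (V - nb v)) * real (d v)"
      by (metis of_nat_add of_nat_le_iff of_nat_mult)
    also have "\<dots> \<le> real (p choose r) * (real (card (nb v)) / real p) ^ r
        + real (card (V - nb v)) * (real (p choose s) * (real (card (nb v)) / real p) ^ s)"
      unfolding d_def using Suc.IH[OF nb(2) free] by (intro add_mono mult_left_mono) auto
    also have "\<dots> \<le> real (Suc p choose r) * ((real (card (V - nb v))
        + real p * (real (card (nb v)) / real p)) / real (Suc p)) ^ r"
      unfolding r by (rule binomial_balance_le) auto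
    \<comment> \<open>If \<open>p = 0\<close> the quotient does not cancel, but then the neighbourhood is empty.\<close>
    also have "real (card (V - nb v)) + real p * (real (card (nb v)) / real p) = real (card V)"
    proof -
      have "p = 0 \<Longrightarrow> nb v = {}"
      proof (rule ccontr)
        assume "p = 0" "nb v \<noteq> {}"
        then obtain w where "w \<in> nb v" by blast
        then have "{w} \<in> cliques adj (Suc p) (nb v)"
          using \<open>p = 0\<close> by (auto simp: cliques_def clique_def)
        with free show False by simp
      qed
      moreover have "card (V - nb v) + card (nb v) = card V"
        using fin nb card_mono[of V "nb v"] by (simp add: card_Diff_subset)
      ultimately show ?thesis by (cases "p = 0") auto
    qed
    finally show ?thesis .
  qed
qed

section \<open>Dense systems of tuples contain large boxes\<close>

text \<open>
  The averaging step of the counting arguments below: as no single point contributes more than \<open>b\<close>, a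
  sum well above \<open>c * card X\<close> forces many points with values above \<open>c\<close>.
\<close>

lemma sum_le_popular:
  fixes f :: "'x \<Rightarrow> real"
  assumes "finite X" "0 \<le> c" "\<And>x. x \<in> X \<Longrightarrow> f x \<le> b"
  shows "sum f X \<le> b * real (card {x \<in> X. c < f x}) + c * real (card X)"
proof -
  have "sum f X = sum f {x \<in> X. c < f x} + sum f {x \<in> X. \<not> c < f x}"
    using assms(1) by (subst sum.union_disjoint[symmetric]) (auto intro!: sum.cong)
  also have "\<dots> \<le> (\<Sum>x\<in>{x \<in> X. c < f x}. b) + (\<Sum>x\<in>{x \<in> X. \<not> c < f x}. c)"
    by (intro add_mono sum_mono) (use assms in auto)
  also have "\<dots> \<le> b * real (card {x \<in> X. c < f x}) + c * real (card X)"
    using card_mono[OF assms(1), of "{x \<in> X. \<not> c < f x}"] assms(2)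
    by (simp add: mult.commute mult_left_mono)
  finally show ?thesis .
qed

definition tuples :: "nat \<Rightarrow> nat \<Rightarrow> nat list set" where
  "tuples N n = {xs. length xs = N \<and> set xs \<subseteq> {..<n}}"

lemma tuples: "finite (tuples N n)" "card (tuples N n) = n ^ N"
proof -
  have eq: "tuples N n = {xs. set xs \<subseteq> {..<n} \<and> length xs = N}" by (auto simp: tuples_def)
  show "finite (tuples N n)" "card (tuples N n) = n ^ N" unfolding eq
    by (simp_all add: finite_lists_length_eq card_lists_length_eq)
qed

text \<open>
  Erdos's theorem on complete multipartite subsystems, in ordered form: for large \<open>n\<close>, a set with a
  positive proportion of all \<open>N\<close>-tuples contains a product of \<open>N\<close> sets of size \<open>t\<close>.

  In the induction step a constant number \<open>b\<close> of popular first coordinates is fixed. On average a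
  tail extends a proportion of at least \<open>\<delta> / 2\<close> of them, so many tails extend at least \<open>t\<close> of them.
  There are only \<open>2 ^ b\<close> possibilities for the set of first coordinates that a tail extends, so many
  tails share the same set. It contains the first factor, and the induction hypothesis for these
  tails gives the others.
\<close>

lemma box_theorem:
  assumes "\<delta> > 0"
  shows "\<exists>n0. \<forall>n\<ge>n0. \<forall>S\<subseteq>tuples N n. \<delta> * real n ^ N \<le> real (card S) \<longrightarrow>
     (\<exists>A. (\<forall>i<N. card (A i) = t) \<and> (\<forall>xs. length xs = N \<longrightarrow> (\<forall>i<N. xs ! i \<in> A i) \<longrightarrow> xs \<in> S))"
  using assms
proof (induction N arbitrary: \<delta>)
  case 0
  have "xs \<in> S" if "S \<subseteq> tuples 0 n" "\<delta> \<le> real (card S)" "length xs = 0" for n S and xs :: "nat list"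
  proof -
    have "S \<noteq> {}" using that 0 by auto
    then show ?thesis using that by (auto simp: tuples_def)
  qed
  then show ?case by (intro exI[of _ 0]) simp
next
  case (Suc N)
  \<comment> \<open>With this \<open>b\<close>, tails extending at most \<open>t\<close> first coordinates account for at most half of the pairs.\<close>
  define b where "b = Suc (nat \<lceil>4 * real t / \<delta>\<rceil>)"
  have b: "b > 0" "real t \<le> real b * \<delta> / 4"
  proof -
    have "4 * real t / \<delta> \<le> real b" unfolding b_def by linarith
    then show "real t \<le> real b * \<delta> / 4" using Suc.prems by (simp add: field_simps)
  qed (simp add: b_def)
  \<comment> \<open>The factor 4 pays for the two averaging steps, \<open>2 ^ b\<close> for the pigeonhole step.\<close>
  define \<delta>' where "\<delta>' = \<delta> / 4 / 2 ^ b"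
  have "\<delta>' > 0" using Suc.prems by (simp add: \<delta>'_def)
  from Suc.IH[OF this] obtain n1 where n1: "\<And>n S. n \<ge> n1 \<Longrightarrow> S \<subseteq> tuples N n \<Longrightarrow>
     \<delta>' * real n ^ N \<le> real (card S) \<Longrightarrow>
     (\<exists>A. (\<forall>i<N. card (A i) = t) \<and> (\<forall>xs. length xs = N \<longrightarrow> (\<forall>i<N. xs ! i \<in> A i) \<longrightarrow> xs \<in> S))"
    by metis
  define n0 where "n0 = Suc (max n1 (nat \<lceil>2 * real b / \<delta>\<rceil>))"
  show ?case
  proof (intro exI[of _ n0] allI impI)
    fix n S
    assume n: "n0 \<le> n" and S: "S \<subseteq> tuples (Suc N) n" and dense: "\<delta> * real n ^ Suc N \<le> real (card S)"
    have n_pos: "n > 0" and "n \<ge> n1" and n_b: "real b \<le> \<delta> / 2 * real n"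
    proof -
      have "2 * real b / \<delta> \<le> real n" using n unfolding n0_def by linarith
      then show "real b \<le> \<delta> / 2 * real n" using Suc.prems by (simp add: field_simps)
    qed (use n in \<open>auto simp: n0_def\<close>)
    define link where "link v = {ys. v # ys \<in> S}" for v
    have link: "link v \<subseteq> tuples N n" for v
      using S by (force simp: link_def tuples_def)
    have finlink: "finite (link v)" for v using finite_subset[OF link tuples(1)] .
    have card_link: "real (card (link v)) \<le> real n ^ N" for v
      using card_mono[OF tuples(1) link] by (simp add: tuples(2) flip: of_nat_power)
    have "S = (\<Union>v<n. (#) v ` link v)"
    proof
      show "S \<subseteq> (\<Union>v<n. (#) v ` link v)"
      proof
        fix xs assume xs: "xs \<in> S"
        with S have "xs \<in> tuples (Suc N) n" by blast
        then obtain v ys where "xs = v # ys" "v < n" by (auto simp: tuples_def length_Suc_conv)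
        with xs show "xs \<in> (\<Union>v<n. (#) v ` link v)" by (auto simp: link_def)
      qed
    qed (auto simp: link_def)
    then have "card S = (\<Sum>v<n. card ((#) v ` link v))"
      using finlink by (simp only:) (rule card_UN_disjoint, auto)
    also have "\<dots> = (\<Sum>v<n. card (link v))" by (intro sum.cong card_image) (auto intro: inj_onI)
    finally have "real (card S) = (\<Sum>v<n. real (card (link v)))" by simp
    also have "\<dots> \<le> real n ^ N * real (card {v\<in>{..<n}. \<delta> / 2 * real n ^ N < real (card (link v))})
        + \<delta> / 2 * real n ^ N * real (card {..<n})"
      by (rule sum_le_popular) (use card_link Suc.prems in auto)
    finally have "real n ^ N * (\<delta> / 2 * real n) \<le>
        real n ^ N * real (card {v\<in>{..<n}. \<delta> / 2 * real n ^ N < real (card (link v))})"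
      using dense by (simp add: algebra_simps)
    then have "\<delta> / 2 * real n \<le> real (card {v\<in>{..<n}. \<delta> / 2 * real n ^ N < real (card (link v))})"
      using n_pos by (subst (asm) mult_le_cancel_left_pos) auto
    with n_b have "b \<le> card {v\<in>{..<n}. \<delta> / 2 * real n ^ N < real (card (link v))}" by linarith
    then obtain B where B: "B \<subseteq> {v\<in>{..<n}. \<delta> / 2 * real n ^ N < real (card (link v))}"
        "card B = b" "finite B"
      by (rule obtain_subset_with_card_n)
    define T where "T ys = {v \<in> B. v # ys \<in> S}" for ys
    define Y where "Y = {ys \<in> tuples N n. real t < real (card (T ys))}"
    have "real b * (\<delta> / 2 * real n ^ N) = (\<Sum>v\<in>B. \<delta> / 2 * real n ^ N)" using B by simp
    also have "\<dots> \<le> (\<Sum>v\<in>B. real (card (link v)))" using B by (intro sum_mono) (auto intro: less_imp_le)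
    also have "\<dots> = (\<Sum>v\<in>B. \<Sum>ys\<in>tuples N n. of_bool (v # ys \<in> S))"
    proof (intro sum.cong refl)
      fix v
      have "link v = {ys \<in> tuples N n. v # ys \<in> S}" using link by (auto simp: link_def)
      then show "real (card (link v)) = (\<Sum>ys\<in>tuples N n. of_bool (v # ys \<in> S))"
        using tuples(1) by (simp add: sum.If_cases of_bool_def Int_def)
    qed
    also have "\<dots> = (\<Sum>ys\<in>tuples N n. \<Sum>v\<in>B. of_bool (v # ys \<in> S))" by (rule sum.swap)
    also have "\<dots> = (\<Sum>ys\<in>tuples N n. real (card (T ys)))"
      using B by (simp add: sum.If_cases of_bool_def Int_def T_def)
    also have "\<dots> \<le> real b * real (card Y) + real t * real (card (tuples N n))"
      unfolding Y_def using B card_mono[OF B(3)] by (intro sum_le_popular tuples) (auto simp: T_def)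
    also have "\<dots> \<le> real b * real (card Y) + real b * \<delta> / 4 * real n ^ N"
      using mult_right_mono[OF b(2), of "real n ^ N"] by (simp add: tuples)
    finally have "real b * (\<delta> / 4 * real n ^ N) \<le> real b * real (card Y)" by (simp add: field_simps)
    then have Y: "\<delta> / 4 * real n ^ N \<le> real (card Y)" using b by (subst (asm) mult_le_cancel_left_pos) auto
    have "T \<in> Y \<rightarrow> Pow B" by (auto simp: T_def)
    moreover have "finite Y" using tuples(1) by (simp add: Y_def)
    ultimately obtain T0 where T0: "T0 \<subseteq> B" "card Y \<le> card (T -` {T0} \<inter> Y) * 2 ^ b"
      using pigeonhole_card[of T Y "Pow B"] B by (auto simp: card_Pow)
    define S' where "S' = T -` {T0} \<inter> Y"
    have "real (card Y) \<le> real (card S') * 2 ^ b"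
      using T0(2) unfolding S'_def by (metis of_nat_le_iff of_nat_mult of_nat_numeral of_nat_power)
    with Y have S'card: "\<delta>' * real n ^ N \<le> real (card S')" by (simp add: \<delta>'_def field_simps)
    have "S' \<subseteq> tuples N n" by (auto simp: S'_def Y_def)
    from n1[OF \<open>n \<ge> n1\<close> this S'card] obtain A where
      A: "\<And>i. i < N \<Longrightarrow> card (A i) = t" "\<And>xs. length xs = N \<Longrightarrow> \<forall>i<N. xs ! i \<in> A i \<Longrightarrow> xs \<in> S'" by blast
    have "\<delta>' * real n ^ N > 0" using \<open>\<delta>' > 0\<close> n_pos by simp
    with S'card have "S' \<noteq> {}" by auto
    then have "t \<le> card T0" by (auto simp: S'_def Y_def)
    then obtain T1 where T1: "T1 \<subseteq> T0" "card T1 = t" by (rule obtain_subset_with_card_n)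
    show "\<exists>A. (\<forall>i<Suc N. card (A i) = t) \<and>
        (\<forall>xs. length xs = Suc N \<longrightarrow> (\<forall>i<Suc N. xs ! i \<in> A i) \<longrightarrow> xs \<in> S)"
    proof (intro exI[of _ "\<lambda>i. case i of 0 \<Rightarrow> T1 | Suc j \<Rightarrow> A j"] conjI allI impI)
      fix i assume "i < Suc N"
      then show "card (case i of 0 \<Rightarrow> T1 | Suc j \<Rightarrow> A j) = t" using A T1 by (cases i) auto
    next
      fix xs :: "nat list"
      assume "length xs = Suc N" and mem: "\<forall>i<Suc N. xs ! i \<in> (case i of 0 \<Rightarrow> T1 | Suc j \<Rightarrow> A j)"
      then obtain v ys where xs: "xs = v # ys" and ys: "length ys = N" by (auto simp: length_Suc_conv)
      have "v \<in> T1" using mem xs by force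
      have "\<forall>i<N. ys ! i \<in> A i"
      proof (intro allI impI)
        fix i assume "i < N"
        then show "ys ! i \<in> A i" using mem[rule_format, of "Suc i"] xs by simp
      qed
      then have "ys \<in> S'" using A ys by blast
      then have "T ys = T0" by (auto simp: S'_def)
      then show "xs \<in> S" using \<open>v \<in> T1\<close> T1 xs by (auto simp: T_def)
    qed
  qed
qed

section \<open>Mapping the expansion into a hypergraph with many cliques\<close>

text \<open>
  The vertex sets of the complete \<open>k\<close>-uniform hypergraphs on \<open>r\<close> vertices with hyperedges in \<open>E\<close>.
  The hyperedges are a parameter separate from the vertex set \<open>W\<close> so that the same \<open>E\<close> can be
  restricted to subsets \<open>W\<close>.
\<close>

definition clique_sets :: "nat \<Rightarrow> 'v set set \<Rightarrow> nat \<Rightarrow> 'v set \<Rightarrow> 'v set set" where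
  "clique_sets k E r W = {A. A \<subseteq> W \<and> card A = r \<and> (\<forall>e\<subseteq>A. card e = k \<longrightarrow> e \<in> E)}"

lemma finite_clique_sets: "finite W \<Longrightarrow> finite (clique_sets k E r W)"
  by (rule finite_subset[of _ "Pow W"]) (auto simp: clique_sets_def)

text \<open>
  These maps are exactly what becomes an embedding in a large enough blow-up: different
  vertices may share an image unless some hyperedge contains both.
\<close>

definition edge_injective_hom ::
    "'x hypergraph \<Rightarrow> 'v set set \<Rightarrow> 'v set \<Rightarrow> ('x \<Rightarrow> 'v) \<Rightarrow> bool" where
  "edge_injective_hom F E W \<tau> \<longleftrightarrow>
     \<tau> ` verts F \<subseteq> W \<and> (\<forall>e\<in>edges F. inj_on \<tau> e \<and> \<tau> ` e \<in> E)"

text \<open>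
  Zykov's bound, applied to the graph joining two vertices that lie in a common clique, gives \<open>p + 1\<close>
  vertices with a common clique for every pair. They serve as the images of the colour classes of
  \<open>F\<^sub>0\<close>, and the new vertices of an edge go into the clique of the pair of colours on that edge.
\<close>

lemma expansion_hom_into_dense:
  fixes F\<^sub>0 :: "'a hypergraph" and W :: "'v set"
  assumes F0: "simple_graph F\<^sub>0" and col: "proper_coloring F\<^sub>0 (Suc p) f"
    and k: "2 \<le> k" "k \<le> r" and W: "finite W"
    and dense: "real (p choose r) * (real (card W) / real p) ^ r < real (card (clique_sets k E r W))"
  shows "\<exists>\<tau>. edge_injective_hom (expansion k F\<^sub>0) E W \<tau>"
proof -
  let ?R = "clique_sets k E r W"
  define adj where "adj x y \<longleftrightarrow> x \<noteq> y \<and> (\<exists>A\<in>?R. x \<in> A \<and> y \<in> A)" for x y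
  have "?R \<subseteq> cliques adj r W"
    by (auto simp: cliques_def clique_def adj_def clique_sets_def)
  then have "card ?R \<le> card (cliques adj r W)" by (intro card_mono finite_cliques W)
  then have "\<not> real (card (cliques adj r W)) \<le> real (p choose r) * (real (card W) / real p) ^ r"
    using dense by linarith
  then have "cliques adj (Suc p) W \<noteq> {}"
    using zykov_clique_bound[of adj W p r] W by (auto simp: adj_def)
  then obtain C where C: "C \<subseteq> W" "card C = Suc p" "clique adj C" by (auto simp: cliques_def)
  then have "finite C" using W finite_subset by blast
  then obtain h where h: "bij_betw h {..<Suc p} C"
    using finite_same_card_bij[of "{..<Suc p}" C] C by auto
  define c where "c v = h (f v)" for v
  have c_in: "c v \<in> C" if "v \<in> verts F\<^sub>0" for v
    using that col bij_betwE[OF h] by (auto simp: c_def proper_coloring_def)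
  \<comment> \<open>\<open>A\<close> is the clique receiving the edge \<open>e\<close>, and \<open>s\<close> places the new vertices of \<open>e\<close> in \<open>A\<close> off the
    images of the two ends of \<open>e\<close>.\<close>
  define extends where "extends e A s \<longleftrightarrow> A \<in> ?R \<and> c ` e \<subseteq> A \<and> inj_on c e \<and>
      inj_on s {..<k - 2} \<and> s ` {..<k - 2} \<subseteq> A - c ` e" for e A and s :: "nat \<Rightarrow> 'v"
  have "\<exists>A s. extends e A s" if e: "e \<in> edges F\<^sub>0" for e
  proof -
    obtain u v where uv: "e = {u, v}" "u \<noteq> v"
      using F0 e by (auto simp: uniform_hypergraph_def card_2_iff)
    have mem: "u \<in> verts F\<^sub>0" "v \<in> verts F\<^sub>0"
      using F0 e uv by (auto simp: uniform_hypergraph_def hypergraph_def)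
    have "f u \<noteq> f v" "f u \<in> {..<Suc p}" "f v \<in> {..<Suc p}"
      using col e uv mem by (auto simp: proper_coloring_def)
    then have ne: "c u \<noteq> c v" using h unfolding c_def bij_betw_def by (meson inj_onD)
    then have "adj (c u) (c v)" using C c_in mem by (auto simp: clique_def)
    then obtain A where A: "A \<in> ?R" "c u \<in> A" "c v \<in> A" by (auto simp: adj_def)
    then have fA: "finite A" and cA: "card A = r"
      using W finite_subset by (auto simp: clique_sets_def)
    have "card (A - {c u, c v}) = r - 2" using A ne cA fA by (subst card_Diff_subset) auto
    then have "card {..<k - 2} \<le> card (A - {c u, c v})" using k by simp
    then obtain s where "inj_on s {..<k - 2}" "s ` {..<k - 2} \<subseteq> A - {c u, c v}"
      using card_le_inj[of "{..<k - 2}" "A - {c u, c v}"] fA by auto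
    then show ?thesis using A uv ne unfolding extends_def by (intro exI[of _ A] exI[of _ s]) auto
  qed
  then obtain A s where "\<And>e. e \<in> edges F\<^sub>0 \<Longrightarrow> extends e (A e) (s e)"
    by metis
  then have As: "A e \<in> ?R" "c ` e \<subseteq> A e" "inj_on c e" "inj_on (s e) {..<k - 2}"
      "s e ` {..<k - 2} \<subseteq> A e - c ` e" if "e \<in> edges F\<^sub>0" for e
    using that unfolding extends_def by blast+
  define \<tau> where "\<tau> = case_sum c (\<lambda>(e, i). s e i)"
  have pairs: "{e} \<times> {..<k - 2} = Pair e ` {..<k - 2}" for e :: "'a set" by auto
  have img: "\<tau> ` expansion_edge k e = c ` e \<union> s e ` {..<k - 2}" for e
    unfolding expansion_edge_def pairs image_Un image_image by (simp add: \<tau>_def)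
  have card_e: "card e = 2" "finite e" if "e \<in> edges F\<^sub>0" for e
    using F0 that by (auto simp: uniform_hypergraph_def intro: card_ge_0_finite)
  \<comment> \<open>Injectivity on an edge is obtained by counting its image.\<close>
  have card_img: "card (\<tau> ` expansion_edge k e) = k" if "e \<in> edges F\<^sub>0" for e
  proof -
    have "card (\<tau> ` expansion_edge k e) = card (c ` e) + card (s e ` {..<k - 2})"
      unfolding img using As(5)[OF that] card_e[OF that] by (intro card_Un_disjoint) auto
    also have "\<dots> = 2 + (k - 2)"
      using As(3,4)[OF that] card_e[OF that] by (simp add: card_image)
    finally show ?thesis using k by simp
  qed
  have inj: "inj_on \<tau> (expansion_edge k e)" if "e \<in> edges F\<^sub>0" for e
  proof (rule eq_card_imp_inj_on)
    show "finite (expansion_edge k e)" using card_e[OF that] by (simp add: expansion_edge_def)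
    have "card (expansion_edge k e) = card e + (k - 2)"
      unfolding expansion_edge_def using card_e[OF that]
      by (subst card_Un_disjoint) (auto simp: card_image)
    then show "card (\<tau> ` expansion_edge k e) = card (expansion_edge k e)"
      using card_img[OF that] card_e[OF that] k by simp
  qed
  have "\<tau> ` expansion_edge k e \<subseteq> A e" if "e \<in> edges F\<^sub>0" for e
    using As(2,5)[OF that] unfolding img by blast
  with card_img have edge: "\<tau> ` expansion_edge k e \<in> E" if "e \<in> edges F\<^sub>0" for e
    using As(1)[OF that] that unfolding clique_sets_def by blast
  have "\<tau> x \<in> W" if "x \<in> verts (expansion k F\<^sub>0)" for x
  proof -
    from that consider v where "x = Inl v" "v \<in> verts F\<^sub>0"
      | e i where "x = Inr (e, i)" "e \<in> edges F\<^sub>0" "i < k - 2"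
      by (auto simp: expansion_def)
    then show ?thesis
    proof cases
      case 1
      then show ?thesis using c_in C by (auto simp: \<tau>_def)
    next
      case 2
      then have "s e i \<in> A e" "A e \<subseteq> W" using As(1,5)[of e] by (auto simp: clique_sets_def)
      then show ?thesis using 2 by (auto simp: \<tau>_def)
    qed
  qed
  then have "edge_injective_hom (expansion k F\<^sub>0) E W \<tau>"
    using inj edge by (auto simp: edge_injective_hom_def expansion_def)
  then show ?thesis by blast
qed

section \<open>From many maps to a copy\<close>

text \<open>
  The list \<open>xs\<close> ranges over the transversals of the blow-up, and \<open>\<rho>\<close> is the map being blown up. Each
  vertex of \<open>F\<close> receives an element of its own in the class \<open>A (\<rho> x)\<close>; elements of different classes
  are distinct because transversals are. As \<open>\<rho>\<close> is injective on a hyperedge, some transversal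
  passes through the chosen images of all its vertices. The classes have one element more than \<open>F\<close>
  has vertices, so that they are nonempty and transversals exist even when \<open>F\<close> has no vertex.
\<close>

lemma blow_up_contains:
  fixes F :: "'x hypergraph" and n N :: nat
  assumes F: "hypergraph F"
    and \<rho>: "\<rho> ` verts F \<subseteq> {..<N}" "\<And>e. e \<in> edges F \<Longrightarrow> inj_on \<rho> e"
    and A: "\<And>i. i < N \<Longrightarrow> card (A i) = Suc (card (verts F))"
    and S: "\<And>xs. length xs = N \<Longrightarrow> \<forall>i<N. xs ! i \<in> A i \<Longrightarrow>
        distinct xs \<and> set xs \<subseteq> {..<n} \<and> (\<forall>e\<in>edges F. (\<lambda>x. xs ! \<rho> x) ` e \<in> E)"
  shows "\<exists>g. inj_on g (verts F) \<and> g ` verts F \<subseteq> {..<n} \<and> (\<forall>e\<in>edges F. g ` e \<in> E)"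
proof -
  have finF: "finite (verts F)" using F by (simp add: hypergraph_def)
  have finA: "finite (A i)" if "i < N" for i using A[OF that] by (simp add: card_ge_0_finite)
  have "\<exists>a. inj_on a (verts F) \<and> a ` verts F \<subseteq> A i" if "i < N" for i
    using card_le_inj[OF finF finA[OF that]] A[OF that] by auto
  then obtain a where a: "\<And>i. i < N \<Longrightarrow> inj_on (a i) (verts F)" "\<And>i. i < N \<Longrightarrow> a i ` verts F \<subseteq> A i"
    by metis
  have "\<exists>b. b \<in> A i" if "i < N" for i using A[OF that] by (metis all_not_in_conv card.empty nat.distinct(1))
  then obtain b where b: "\<And>i. i < N \<Longrightarrow> b i \<in> A i" by metis
  define g where "g x = a (\<rho> x) x" for x
  have gA: "g x \<in> A (\<rho> x)" "\<rho> x < N" if "x \<in> verts F" for x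
  proof -
    show "\<rho> x < N" using that \<rho> by auto
    then show "g x \<in> A (\<rho> x)" using a(2) that by (auto simp: g_def)
  qed
  have transversal: "\<exists>xs. distinct xs \<and> length xs = N \<and> set xs \<subseteq> {..<n} \<and>
        (\<forall>e\<in>edges F. (\<lambda>x. xs ! \<rho> x) ` e \<in> E) \<and> (\<forall>x\<in>X. xs ! \<rho> x = g x)"
    if X: "X \<subseteq> verts F" "inj_on \<rho> X" for X
  proof -
    \<comment> \<open>The classes not met by \<open>X\<close> are represented by the arbitrary elements \<open>b i\<close>.\<close>
    define y where "y i = (if i \<in> \<rho> ` X then g (the_inv_into X \<rho> i) else b i)" for i
    have y: "y (\<rho> x) = g x" if "x \<in> X" for x
      using that X by (simp add: y_def the_inv_into_f_f)
    have yA: "y i \<in> A i" if "i < N" for i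
    proof (cases "i \<in> \<rho> ` X")
      case True
      then show ?thesis using y gA X by auto
    next
      case False
      then show ?thesis using b that by (simp add: y_def)
    qed
    then have "\<forall>i<N. map y [0..<N] ! i \<in> A i" by simp
    from S[OF _ this] have "distinct (map y [0..<N])" "set (map y [0..<N]) \<subseteq> {..<n}"
      "\<forall>e\<in>edges F. (\<lambda>x. map y [0..<N] ! \<rho> x) ` e \<in> E" by auto
    moreover have "\<forall>x\<in>X. map y [0..<N] ! \<rho> x = g x" using y gA(2) X by auto
    ultimately show ?thesis by (intro exI[of _ "map y [0..<N]"]) simp
  qed
  have "inj_on g (verts F)"
  proof (rule inj_onI, rule ccontr)
    fix x z assume xz: "x \<in> verts F" "z \<in> verts F" "g x = g z" "x \<noteq> z"
    then have "\<rho> x \<noteq> \<rho> z" using a(1) gA(2) by (metis g_def inj_onD)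
    then have "inj_on \<rho> {x, z}" by auto
    with transversal[of "{x, z}"] xz obtain xs where
      "distinct xs" "length xs = N" "xs ! \<rho> x = g x" "xs ! \<rho> z = g z" by auto
    then show False using xz gA(2) \<open>\<rho> x \<noteq> \<rho> z\<close> by (metis nth_eq_iff_index_eq)
  qed
  moreover have "g ` verts F \<subseteq> {..<n}"
  proof
    fix y assume "y \<in> g ` verts F"
    then obtain x where x: "x \<in> verts F" "y = g x" by blast
    with transversal[of "{x}"] obtain xs where "length xs = N" "set xs \<subseteq> {..<n}" "xs ! \<rho> x = g x"
      by auto
    then show "y \<in> {..<n}" using x gA(2)[of x] nth_mem[of "\<rho> x" xs] by auto
  qed
  moreover have "g ` e \<in> E" if "e \<in> edges F" for e
  proof -
    have "e \<subseteq> verts F" using F that by (simp add: hypergraph_def)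
    with transversal[of e] \<rho>(2) that obtain xs where
      "(\<lambda>x. xs ! \<rho> x) ` e \<in> E" "\<forall>x\<in>e. xs ! \<rho> x = g x" by blast
    then show ?thesis by (metis (no_types, lifting) image_cong)
  qed
  ultimately show ?thesis by blast
qed

lemma copies_if_embedding:
  fixes F :: "'x hypergraph" and H :: "'v hypergraph"
  assumes F: "hypergraph F" and g: "inj_on g (verts F)" "g ` verts F \<subseteq> verts H"
    "\<And>e. e \<in> edges F \<Longrightarrow> g ` e \<in> edges H"
  shows "copies H F \<noteq> {}"
proof -
  let ?S = "Hypergraph (g ` verts F) ((`) g ` edges F)"
  have sub: "e \<subseteq> verts F" if "e \<in> edges F" for e using F that by (simp add: hypergraph_def)
  have "subhypergraph ?S H"
    using F g sub by (force simp: subhypergraph_def hypergraph_def)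
  moreover have "isomorphic ?S F"
  proof -
    let ?h = "the_inv_into (verts F) g"
    have "?h ` g ` e = e" if "e \<in> edges F" for e
      using sub[OF that] g(1) by (force simp: image_image the_inv_into_f_f)
    then have "(`) ?h ` (`) g ` edges F = edges F" by (force simp: image_image)
    moreover have "bij_betw ?h (g ` verts F) (verts F)"
      using g(1) by (simp add: bij_betw_the_inv_into inj_on_imp_bij_betw)
    ultimately show ?thesis by (auto simp: isomorphic_def)
  qed
  ultimately show ?thesis by (auto simp: copies_def)
qed

text \<open>
  Identify every \<open>N\<close>-set with its increasing list. A map from \<open>F\<close> into an \<open>N\<close>-set becomes a map into
  the fixed set \<open>{..<N}\<close> of positions, for which there are boundedly many possibilities. The most
  popular one is shared by a positive proportion of all lists, and these lists contain a large box.
\<close>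

lemma many_homs_imp_copy:
  fixes F :: "'x hypergraph"
  assumes F: "hypergraph F" and "\<delta> > 0"
  shows "\<exists>n0. \<forall>n\<ge>n0. \<forall>H \<W>. verts H = {..<n} \<longrightarrow>
     (\<forall>W\<in>\<W>. W \<subseteq> {..<n} \<and> card W = N \<and> (\<exists>\<tau>. edge_injective_hom F (edges H) W \<tau>)) \<longrightarrow>
     \<delta> * real n ^ N \<le> real (card \<W>) \<longrightarrow> copies H F \<noteq> {}"
proof -
  have finF: "finite (verts F)" using F by (simp add: hypergraph_def)
  define L where "L = N ^ card (verts F)"
  \<comment> \<open>\<open>Suc L\<close> instead of \<open>L\<close> because \<open>L\<close> may be \<open>0\<close>, when \<open>N = 0\<close>.\<close>
  define \<delta>' where "\<delta>' = \<delta> / real (Suc L)"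
  have "\<delta>' > 0" using assms by (simp add: \<delta>'_def)
  from box_theorem[OF this, of N "Suc (card (verts F))"] obtain n0 where n0:
    "\<And>n S. n \<ge> n0 \<Longrightarrow> S \<subseteq> tuples N n \<Longrightarrow> \<delta>' * real n ^ N \<le> real (card S) \<Longrightarrow>
     \<exists>A. (\<forall>i<N. card (A i) = Suc (card (verts F))) \<and>
         (\<forall>xs. length xs = N \<longrightarrow> (\<forall>i<N. xs ! i \<in> A i) \<longrightarrow> xs \<in> S)" by metis
  have "copies H F \<noteq> {}" if n: "n \<ge> Suc n0" and H: "verts H = {..<n}"
    and \<W>: "\<And>W. W \<in> \<W> \<Longrightarrow> W \<subseteq> {..<n} \<and> card W = N \<and> (\<exists>\<tau>. edge_injective_hom F (edges H) W \<tau>)"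
    and dense: "\<delta> * real n ^ N \<le> real (card \<W>)" for n and H :: "nat hypergraph" and \<W>
  proof -
    let ?l = "sorted_list_of_set :: nat set \<Rightarrow> nat list"
    have finW: "finite W" if "W \<in> \<W>" for W using \<W>[OF that] finite_subset by blast
    have "finite \<W>" by (rule finite_subset[of _ "Pow {..<n}"]) (use \<W> in auto)
    have "\<exists>\<rho>. \<rho> \<in> verts F \<rightarrow>\<^sub>E {..<N} \<and>
        (\<forall>e\<in>edges F. inj_on \<rho> e \<and> (\<lambda>x. ?l W ! \<rho> x) ` e \<in> edges H)" if W: "W \<in> \<W>" for W
    proof -
      obtain \<tau> where \<tau>: "edge_injective_hom F (edges H) W \<tau>" using \<W>[OF W] by blast
      have len: "length (?l W) = N" using \<W>[OF W] by simp
      have set: "set (?l W) = W" using finW[OF W] by simp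
      have "\<forall>x\<in>verts F. \<exists>i<N. ?l W ! i = \<tau> x"
      proof
        fix x assume "x \<in> verts F"
        then have "\<tau> x \<in> set (?l W)" using \<tau> set by (auto simp: edge_injective_hom_def)
        then show "\<exists>i<N. ?l W ! i = \<tau> x" using len by (metis in_set_conv_nth)
      qed
      then obtain i where i: "\<And>x. x \<in> verts F \<Longrightarrow> i x < N \<and> ?l W ! i x = \<tau> x" by metis
      let ?\<rho> = "restrict i (verts F)"
      have \<rho>: "?l W ! ?\<rho> x = \<tau> x" if "e \<in> edges F" "x \<in> e" for e x
        using that i F by (auto simp: hypergraph_def)
      have "inj_on ?\<rho> e \<and> (\<lambda>x. ?l W ! ?\<rho> x) ` e \<in> edges H" if e: "e \<in> edges F" for e
      proof
        have "inj_on \<tau> e" using \<tau> e by (simp add: edge_injective_hom_def)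
        then show "inj_on ?\<rho> e" using \<rho>[OF e] by (metis (no_types, lifting) inj_on_def)
        have "(\<lambda>x. ?l W ! ?\<rho> x) ` e = \<tau> ` e" using \<rho>[OF e] by (intro image_cong) auto
        then show "(\<lambda>x. ?l W ! ?\<rho> x) ` e \<in> edges H" using \<tau> e by (simp add: edge_injective_hom_def)
      qed
      moreover have "?\<rho> \<in> verts F \<rightarrow>\<^sub>E {..<N}" using i by auto
      ultimately show ?thesis by blast
    qed
    then obtain \<rho> where \<rho>: "\<And>W. W \<in> \<W> \<Longrightarrow> \<rho> W \<in> verts F \<rightarrow>\<^sub>E {..<N} \<and>
        (\<forall>e\<in>edges F. inj_on (\<rho> W) e \<and> (\<lambda>x. ?l W ! \<rho> W x) ` e \<in> edges H)" by metis
    have "\<W> \<noteq> {}"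
    proof
      have "\<delta> * real n ^ N > 0" using assms n by simp
      moreover assume "\<W> = {}"
      ultimately show False using dense by simp
    qed
    then have "verts F \<rightarrow>\<^sub>E {..<N} \<noteq> {}" using \<rho> by blast
    then obtain \<rho>0 where \<rho>0: "\<rho>0 \<in> verts F \<rightarrow>\<^sub>E {..<N}" "card \<W> \<le> card (\<rho> -` {\<rho>0} \<inter> \<W>) * L"
      using pigeonhole_card[of \<rho> \<W> "verts F \<rightarrow>\<^sub>E {..<N}"] \<rho> \<open>finite \<W>\<close> finF
      by (auto simp: finite_PiE card_funcsetE L_def)
    define \<W>0 where "\<W>0 = \<rho> -` {\<rho>0} \<inter> \<W>"
    have \<W>0: "W \<in> \<W>" "\<rho> W = \<rho>0" if "W \<in> \<W>0" for W using that by (auto simp: \<W>0_def)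
    have "\<W>0 \<noteq> {}"
      using \<rho>0(2) \<open>\<W> \<noteq> {}\<close> \<open>finite \<W>\<close> unfolding \<W>0_def by (auto simp: card_eq_0_iff)
    have "inj_on ?l \<W>0" using finW \<W>0 by (metis inj_onI set_sorted_list_of_set)
    then have "card (?l ` \<W>0) = card \<W>0" by (rule card_image)
    moreover have "\<delta>' * real n ^ N \<le> real (card \<W>0)"
    proof -
      have "card \<W> \<le> card \<W>0 * Suc L" using \<rho>0(2) by (simp add: \<W>0_def)
      then have "real (card \<W>) \<le> real (card \<W>0) * real (Suc L)"
        by (metis of_nat_le_iff of_nat_mult)
      with dense have "\<delta> * real n ^ N \<le> real (card \<W>0) * real (Suc L)" by linarith
      then show ?thesis by (simp add: \<delta>'_def pos_divide_le_eq)
    qed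
    moreover have "?l ` \<W>0 \<subseteq> tuples N n"
      using \<W> \<W>0 finW by (fastforce simp: tuples_def)
    ultimately obtain A where A: "\<And>i. i < N \<Longrightarrow> card (A i) = Suc (card (verts F))"
        "\<And>xs. length xs = N \<Longrightarrow> \<forall>i<N. xs ! i \<in> A i \<Longrightarrow> xs \<in> ?l ` \<W>0"
      using n0[of n "?l ` \<W>0"] n by auto
    have "\<exists>g. inj_on g (verts F) \<and> g ` verts F \<subseteq> {..<n} \<and> (\<forall>e\<in>edges F. g ` e \<in> edges H)"
    proof (rule blow_up_contains[OF F _ _ A(1), of \<rho>0])
      show "\<rho>0 ` verts F \<subseteq> {..<N}" using \<rho>0 by auto
      show "inj_on \<rho>0 e" if "e \<in> edges F" for e
        using \<open>\<W>0 \<noteq> {}\<close> \<W>0 \<rho> that by blast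
      fix xs :: "nat list" assume "length xs = N" "\<forall>i<N. xs ! i \<in> A i"
      then obtain W where W: "W \<in> \<W>0" "xs = ?l W" using A(2) by blast
      then show "distinct xs \<and> set xs \<subseteq> {..<n} \<and> (\<forall>e\<in>edges F. (\<lambda>x. xs ! \<rho>0 x) ` e \<in> edges H)"
        using \<rho>[of W] \<W>0[of W] \<W>[of W] finW[of W] by auto
    qed
    then show ?thesis using copies_if_embedding[OF F, of _ H] H by metis
  qed
  then show ?thesis by (intro exI[of _ "Suc n0"]) blast
qed

section \<open>Sampling subsets of constant size\<close>

text \<open>
  A copy of a complete hypergraph is determined by its vertices, which turns the counting of copies
  into the counting of \<open>r\<close>-sets.
\<close>

lemma copies_complete_hypergraph:
  assumes H: "uniform_hypergraph k H"
  shows "copies H (complete_hypergraph k r) =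
    (\<lambda>A. Hypergraph A {e. e \<subseteq> A \<and> card e = k}) ` clique_sets k (edges H) r (verts H)"
proof (intro equalityI subsetI)
  fix S assume "S \<in> copies H (complete_hypergraph k r)"
  then obtain f where S: "hypergraph S" "verts S \<subseteq> verts H" "edges S \<subseteq> edges H"
    and f: "bij_betw f (verts S) {..<r}" "(`) f ` edges S = {e. e \<subseteq> {..<r} \<and> card e = k}"
    by (auto simp: copies_def subhypergraph_def isomorphic_def complete_hypergraph_def)
  have "e \<in> edges S" if e: "e \<subseteq> verts S" "card e = k" for e
  proof -
    have "f ` e \<subseteq> {..<r}" using f(1) e by (auto simp: bij_betw_def)
    moreover have "card (f ` e) = k"
      using f(1) e by (metis bij_betw_def card_image inj_on_subset)
    ultimately have "f ` e \<in> (`) f ` edges S" using f(2) by simp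
    then obtain e' where e': "e' \<in> edges S" "f ` e = f ` e'" by blast
    then have "e' \<subseteq> verts S" using S by (auto simp: hypergraph_def)
    then have "e = e'" using e e' f(1) by (metis bij_betw_def inj_on_image_eq_iff)
    with e' show ?thesis by simp
  qed
  then have "edges S = {e. e \<subseteq> verts S \<and> card e = k}"
    using S H by (auto simp: hypergraph_def uniform_hypergraph_def)
  moreover from this have "verts S \<in> clique_sets k (edges H) r (verts H)"
    using S bij_betw_same_card[OF f(1)] by (auto simp: clique_sets_def)
  ultimately show "S \<in> (\<lambda>A. Hypergraph A {e. e \<subseteq> A \<and> card e = k}) ` clique_sets k (edges H) r (verts H)"
    by (intro image_eqI[of _ _ "verts S"]) (auto intro: hypergraph.expand)
next
  fix S assume "S \<in> (\<lambda>A. Hypergraph A {e. e \<subseteq> A \<and> card e = k}) ` clique_sets k (edges H) r (verts H)"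
  then obtain A where A: "A \<subseteq> verts H" "card A = r" "\<And>e. e \<subseteq> A \<Longrightarrow> card e = k \<Longrightarrow> e \<in> edges H"
    and S: "S = Hypergraph A {e. e \<subseteq> A \<and> card e = k}" by (auto simp: clique_sets_def)
  have "finite A" using A H finite_subset by (auto simp: uniform_hypergraph_def hypergraph_def)
  then obtain h where h: "bij_betw h A {..<r}"
    using finite_same_card_bij[of A "{..<r}"] A by auto
  have "(`) h ` {e. e \<subseteq> A \<and> card e = k} = {e. e \<subseteq> {..<r} \<and> card e = k}"
  proof (intro equalityI subsetI)
    fix e assume "e \<in> {e. e \<subseteq> {..<r} \<and> card e = k}"
    then have e: "e \<subseteq> h ` A" "card e = k" using h by (auto simp: bij_betw_def)
    then obtain d where d: "d \<subseteq> A" "e = h ` d" by (auto simp: subset_image_iff)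
    then have "card d = k" using e h by (metis bij_betw_def card_image inj_on_subset)
    then show "e \<in> (`) h ` {e. e \<subseteq> A \<and> card e = k}" using d by blast
  next
    fix e assume "e \<in> (`) h ` {e. e \<subseteq> A \<and> card e = k}"
    then obtain d where d: "d \<subseteq> A" "card d = k" "e = h ` d" by blast
    then have "card e = k" using h by (metis bij_betw_def card_image inj_on_subset)
    then show "e \<in> {e. e \<subseteq> {..<r} \<and> card e = k}" using d h by (auto simp: bij_betw_def)
  qed
  then have "isomorphic S (complete_hypergraph k r)"
    using h S by (auto simp: isomorphic_def complete_hypergraph_def)
  moreover have "subhypergraph S H"
    using A S \<open>finite A\<close> by (auto simp: subhypergraph_def hypergraph_def)
  ultimately show "S \<in> copies H (complete_hypergraph k r)" by (simp add: copies_def)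
qed

lemma card_copies_complete_hypergraph:
  assumes "uniform_hypergraph k H"
  shows "card (copies H (complete_hypergraph k r)) = card (clique_sets k (edges H) r (verts H))"
  unfolding copies_complete_hypergraph[OF assms] by (rule card_image) (auto intro: inj_onI)

lemma card_supersets:
  assumes "finite V" "A \<subseteq> V" "card A \<le> N"
  shows "card {W. W \<subseteq> V \<and> card W = N \<and> A \<subseteq> W} = (card V - card A) choose (N - card A)"
proof -
  have finA: "finite A" using assms finite_subset by blast
  have "{W. W \<subseteq> V \<and> card W = N \<and> A \<subseteq> W} = (\<union>) A ` {B. B \<subseteq> V - A \<and> card B = N - card A}"
  proof (intro equalityI subsetI)
    fix W assume W: "W \<in> {W. W \<subseteq> V \<and> card W = N \<and> A \<subseteq> W}"
    then have "W = A \<union> (W - A)" "W - A \<subseteq> V - A" "card (W - A) = N - card A"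
      using finA by (auto simp: card_Diff_subset)
    then show "W \<in> (\<union>) A ` {B. B \<subseteq> V - A \<and> card B = N - card A}" by blast
  next
    fix W assume "W \<in> (\<union>) A ` {B. B \<subseteq> V - A \<and> card B = N - card A}"
    then obtain B where B: "W = A \<union> B" "B \<subseteq> V - A" "card B = N - card A" by blast
    then have "finite B" "A \<inter> B = {}" using assms(1) finite_subset by blast+
    then have "card W = N" using B finA assms by (simp add: card_Un_disjoint)
    then show "W \<in> {W. W \<subseteq> V \<and> card W = N \<and> A \<subseteq> W}" using B assms by auto
  qed
  moreover have "inj_on ((\<union>) A) {B. B \<subseteq> V - A \<and> card B = N - card A}"
    by (rule inj_onI) blast
  ultimately have "card {W. W \<subseteq> V \<and> card W = N \<and> A \<subseteq> W} = card {B. B \<subseteq> V - A \<and> card B = N - card A}"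
    by (simp add: card_image)
  also have "\<dots> = (card V - card A) choose (N - card A)"
    using assms finA by (simp add: n_subsets card_Diff_subset)
  finally show ?thesis .
qed

text \<open>
  Double counting of the pairs of a clique and an \<open>N\<close>-set containing it: the clique density of \<open>V\<close> is
  the average of the clique densities of its \<open>N\<close>-subsets. Hence it is at most the proportion of
  \<open>N\<close>-sets with more than \<open>c\<close> cliques plus the density \<open>c / (N choose r)\<close>. The inequality is
  multiplied by both binomial coefficients of \<open>card V\<close>.
\<close>

lemma sample_clique_sets:
  fixes V :: "'v set"
  assumes V: "finite V" and N: "r \<le> N" "N \<le> card V" and "0 \<le> c"
  shows "real (card (clique_sets k E r V)) * real (card V choose N) \<le>
     real (card V choose r) * (real (card {W. W \<subseteq> V \<and> card W = N \<and> c < real (card (clique_sets k E r W))})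
       + c / real (N choose r) * real (card V choose N))"
proof -
  let ?n = "card V" and ?R = "clique_sets k E r V" and ?s = "{W. W \<subseteq> V \<and> card W = N}"
  let ?q = "real ((?n - r) choose (N - r))"
  let ?G = "real (card {W. W \<subseteq> V \<and> card W = N \<and> c < real (card (clique_sets k E r W))})"
  have card_s: "card ?s = ?n choose N" "finite ?s" using n_subsets[OF V, of N] V by auto
  have "(\<Sum>W\<in>?s. card {A \<in> ?R. A \<subseteq> W}) = ((?n - r) choose (N - r)) * card ?R"
  proof (rule sum_multicount)
    show "\<forall>A\<in>?R. card {W \<in> ?s. A \<subseteq> W} = (?n - r) choose (N - r)"
    proof
      fix A assume "A \<in> ?R"
      then have "A \<subseteq> V" "card A = r" by (auto simp: clique_sets_def)
      then show "card {W \<in> ?s. A \<subseteq> W} = (?n - r) choose (N - r)"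
        using card_supersets[OF V, of A N] N by simp
    qed
  qed (use card_s V finite_clique_sets in auto)
  moreover have "{A \<in> ?R. A \<subseteq> W} = clique_sets k E r W" if "W \<in> ?s" for W
    using that by (auto simp: clique_sets_def)
  ultimately have "(\<Sum>W\<in>?s. card (clique_sets k E r W)) = ((?n - r) choose (N - r)) * card ?R"
    by simp
  then have "?q * real (card ?R) = (\<Sum>W\<in>?s. real (card (clique_sets k E r W)))"
    by (metis of_nat_mult of_nat_sum)
  also have "\<dots> \<le> real (N choose r) * real (card {W \<in> ?s. c < real (card (clique_sets k E r W))})
       + c * real (card ?s)"
  proof (rule sum_le_popular)
    fix W assume W: "W \<in> ?s"
    then have "finite W" using V finite_subset by blast
    have "clique_sets k E r W \<subseteq> {A. A \<subseteq> W \<and> card A = r}" by (auto simp: clique_sets_def)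
    then have "card (clique_sets k E r W) \<le> card {A. A \<subseteq> W \<and> card A = r}"
      using \<open>finite W\<close> by (intro card_mono) auto
    then show "real (card (clique_sets k E r W)) \<le> real (N choose r)"
      using n_subsets[OF \<open>finite W\<close>, of r] W by simp
  qed (use card_s assms in auto)
  also have "{W \<in> ?s. c < real (card (clique_sets k E r W))} =
      {W. W \<subseteq> V \<and> card W = N \<and> c < real (card (clique_sets k E r W))}" by auto
  finally have main: "?q * real (card ?R) \<le> real (N choose r) * ?G + c * real (?n choose N)"
    by (simp add: card_s)
  have mult: "real (?n choose N) * real (N choose r) = real (?n choose r) * ?q"
    using choose_mult[OF N] by (metis of_nat_mult)
  have pos: "real (N choose r) > 0" using N by simp
  have "real (N choose r) * (real (card ?R) * real (?n choose N)) = real (?n choose r) * (?q * real (card ?R))"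
    using mult by (metis (no_types, opaque_lifting) mult.commute mult.left_commute)
  also have "\<dots> \<le> real (?n choose r) * (real (N choose r) * ?G + c * real (?n choose N))"
    using main by (intro mult_left_mono) auto
  also have "\<dots> = real (N choose r) * (real (?n choose r) * (?G + c / real (N choose r) * real (?n choose N)))"
    using pos by (simp add: field_simps)
  finally show ?thesis using pos by (subst (asm) mult_le_cancel_left_pos)
qed

lemma falling_power_le_binomial: "(N + 1 - r) ^ r \<le> fact r * (N choose r)"
proof (induction r arbitrary: N)
  case (Suc r)
  show ?case
  proof (cases N)
    case (Suc N')
    have "(N + 1 - Suc r) ^ Suc r = (N' + 1 - r) * (N' + 1 - r) ^ r" using Suc by simp
    also have "\<dots> \<le> Suc N' * (fact r * (N' choose r))" by (intro mult_mono Suc.IH) auto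
    also have "\<dots> = fact r * (Suc r * (Suc N' choose Suc r))"
      unfolding Suc_times_binomial by (simp add: algebra_simps)
    also have "\<dots> = fact (Suc r) * (N choose Suc r)" using Suc by (simp add: algebra_simps)
    finally show ?thesis .
  qed simp
qed simp

lemma power_ratio_tendsto_1: "(\<lambda>n. (1 - c / real n) ^ r) \<longlonglongrightarrow> 1"
  using tendsto_power[OF tendsto_diff[OF tendsto_const lim_const_over_n[of c]], of 1 r] by simp

text \<open>
  Zykov's bound is stated with powers while sampling produces binomial coefficients. For large \<open>N\<close> the
  loss in passing from one to the other is as small as desired.
\<close>

lemma ex_binomial_near_power:
  assumes "\<epsilon> > 0"
  shows "\<exists>N\<ge>r. N > 0 \<and> real N ^ r \<le> (1 + \<epsilon>) * fact r * real (N choose r)"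
proof -
  have "1 / (1 + \<epsilon>) < 1" using assms by simp
  then have "\<forall>\<^sub>F N in sequentially. 1 / (1 + \<epsilon>) < (1 - real r / real N) ^ r"
    using power_ratio_tendsto_1 order_tendstoD(1) by blast
  moreover have "\<forall>\<^sub>F N in sequentially. Suc r \<le> N" by (rule eventually_ge_at_top)
  ultimately have "\<forall>\<^sub>F N in sequentially. 1 / (1 + \<epsilon>) < (1 - real r / real N) ^ r \<and> Suc r \<le> N"
    by (rule eventually_conj)
  then obtain N where N: "1 / (1 + \<epsilon>) < (1 - real r / real N) ^ r" "Suc r \<le> N"
    using eventually_happens' sequentially_bot by blast
  have "real N ^ r = real N ^ r * (1 + \<epsilon>) * (1 / (1 + \<epsilon>))" using assms by simp
  also have "\<dots> \<le> real N ^ r * (1 + \<epsilon>) * (1 - real r / real N) ^ r"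
    using N assms by (intro mult_left_mono) auto
  also have "\<dots> = (1 + \<epsilon>) * (real N * (1 - real r / real N)) ^ r"
    by (simp only: power_mult_distrib mult_ac)
  also have "real N * (1 - real r / real N) = real (N - r)"
    using N by (simp add: field_simps)
  also have "(1 + \<epsilon>) * real (N - r) ^ r \<le> (1 + \<epsilon>) * (fact r * real (N choose r))"
  proof (intro mult_left_mono)
    have "(N - r) ^ r \<le> (N + 1 - r) ^ r" by (intro power_mono) auto
    also note falling_power_le_binomial
    finally show "real (N - r) ^ r \<le> fact r * real (N choose r)"
      by (metis of_nat_fact of_nat_le_iff of_nat_mult of_nat_power)
  qed (use assms in auto)
  finally show ?thesis using N by (intro exI[of _ N]) (auto simp: mult.assoc)
qed

lemma hypergraph_expansion:
  assumes "simple_graph F\<^sub>0"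
  shows "hypergraph (expansion k F\<^sub>0)"
proof -
  have "edges F\<^sub>0 \<subseteq> Pow (verts F\<^sub>0)" "finite (verts F\<^sub>0)"
    using assms by (auto simp: uniform_hypergraph_def hypergraph_def)
  then have "finite (edges F\<^sub>0)" using finite_subset by auto
  with assms show ?thesis
    by (auto simp: hypergraph_def expansion_def expansion_edge_def uniform_hypergraph_def)
qed

text \<open>
  The excess \<open>\<epsilon>\<close> in the number of cliques is divided in two halves: one absorbs the difference between
  \<open>N ^ r\<close> and the binomial coefficient in the threshold \<open>M\<close>, and the other yields a positive proportion of
  \<open>N\<close>-sets with more than \<open>M\<close> cliques. Each of these admits a map from the expansion.
\<close>

theorem clique_sets_upper_bound:
  fixes F\<^sub>0 :: "'a hypergraph"
  assumes F0: "simple_graph F\<^sub>0" and col: "proper_coloring F\<^sub>0 (Suc p) f"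
    and k: "2 \<le> k" "k \<le> r" and "r \<le> p" and "\<epsilon> > 0"
  shows "\<forall>\<^sub>F n in sequentially. \<forall>H. uniform_hypergraph k H \<longrightarrow> verts H = {..<n} \<longrightarrow>
     copies H (expansion k F\<^sub>0) = {} \<longrightarrow>
     real (card (clique_sets k (edges H) r {..<n}))
       \<le> (1 + \<epsilon>) * (real (p choose r) * (real n / real p) ^ r)"
proof -
  \<comment> \<open>The limiting clique density of the Turan hypergraph.\<close>
  define c where "c = real (p choose r) * fact r / real p ^ r"
  have "p > 0" using k \<open>r \<le> p\<close> by linarith
  then have c: "c > 0" using \<open>r \<le> p\<close> by (simp add: c_def)
  obtain N where N: "r \<le> N" "N > 0" "real N ^ r \<le> (1 + \<epsilon> / 2) * fact r * real (N choose r)"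
    using ex_binomial_near_power[of "\<epsilon> / 2" r] \<open>\<epsilon> > 0\<close> by auto
  define M where "M = real (p choose r) * (real N / real p) ^ r"
  have cN: "real (N choose r) > 0" using N by simp
  have M: "M / real (N choose r) \<le> c * (1 + \<epsilon> / 2)"
  proof -
    have "M = real (p choose r) / real p ^ r * real N ^ r"
      by (simp add: M_def power_divide)
    also have "\<dots> \<le> real (p choose r) / real p ^ r * ((1 + \<epsilon> / 2) * fact r * real (N choose r))"
      using N by (intro mult_left_mono) auto
    also have "\<dots> = c * (1 + \<epsilon> / 2) * real (N choose r)" by (simp add: c_def)
    finally show ?thesis using cN by (simp add: pos_divide_le_eq)
  qed
  \<comment> \<open>The division by \<open>N ^ N\<close> replaces \<open>n choose N\<close> by \<open>n ^ N\<close>.\<close>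
  define \<delta> where "\<delta> = c * \<epsilon> / 2 / real N ^ N"
  have "\<delta> > 0" using c \<open>\<epsilon> > 0\<close> N by (simp add: \<delta>_def)
  obtain n0 where n0: "\<And>n H \<W>. n \<ge> n0 \<Longrightarrow> verts H = {..<n} \<Longrightarrow>
     (\<forall>W\<in>\<W>. W \<subseteq> {..<n} \<and> card W = N \<and> (\<exists>\<tau>. edge_injective_hom (expansion k F\<^sub>0) (edges H) W \<tau>)) \<Longrightarrow>
     \<delta> * real n ^ N \<le> real (card \<W>) \<Longrightarrow> copies H (expansion k F\<^sub>0) \<noteq> {}"
    using many_homs_imp_copy[OF hypergraph_expansion[OF F0, of k] \<open>\<delta> > 0\<close>, of N] by metis
  have "real (card (clique_sets k (edges H) r {..<n}))
       \<le> (1 + \<epsilon>) * (real (p choose r) * (real n / real p) ^ r)"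
    if n: "n \<ge> max n0 N" and H: "verts H = {..<n}" and free: "copies H (expansion k F\<^sub>0) = {}"
    for n and H :: "nat hypergraph"
  proof (rule ccontr)
    let ?R = "real (card (clique_sets k (edges H) r {..<n}))"
    assume "\<not> ?thesis"
    then have big: "?R > (1 + \<epsilon>) * (real (p choose r) * (real n / real p) ^ r)" by simp
    define \<W> where "\<W> = {W. W \<subseteq> {..<n} \<and> card W = N \<and> M < real (card (clique_sets k (edges H) r W))}"
    have cn: "real (n choose r) > 0" "real (n choose N) > 0" using n N by auto
    have "fact r * real (n choose r) \<le> real n ^ r"
      using binomial_fact_pow[of n r] by (metis mult.commute of_nat_fact of_nat_le_iff of_nat_mult of_nat_power)
    then have "real (p choose r) / real p ^ r * (fact r * real (n choose r))
        \<le> real (p choose r) / real p ^ r * real n ^ r" by (intro mult_left_mono) auto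
    then have "c * real (n choose r) \<le> real (p choose r) * (real n / real p) ^ r"
      by (simp add: c_def power_divide)
    then have "(1 + \<epsilon>) * (c * real (n choose r)) \<le> (1 + \<epsilon>) * (real (p choose r) * (real n / real p) ^ r)"
      using \<open>\<epsilon> > 0\<close> by (intro mult_left_mono) auto
    with big have "(1 + \<epsilon>) * (c * real (n choose r)) \<le> ?R" by linarith
    then have "(1 + \<epsilon>) * (c * real (n choose r)) * real (n choose N) \<le> ?R * real (n choose N)"
      by (rule mult_right_mono) simp
    also have "\<dots> \<le> real (n choose r) * (real (card \<W>) + M / real (N choose r) * real (n choose N))"
      using sample_clique_sets[of "{..<n}" r N M k "edges H"] N n by (simp add: \<W>_def M_def)
    finally have "real (n choose r) * ((1 + \<epsilon>) * c * real (n choose N))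
        \<le> real (n choose r) * (real (card \<W>) + M / real (N choose r) * real (n choose N))"
      by (simp only: mult_ac)
    then have "(1 + \<epsilon>) * c * real (n choose N) \<le> real (card \<W>) + M / real (N choose r) * real (n choose N)"
      using cn by (subst (asm) mult_le_cancel_left_pos) auto
    also have "\<dots> \<le> real (card \<W>) + c * (1 + \<epsilon> / 2) * real (n choose N)"
      using M by (intro add_left_mono mult_right_mono) auto
    finally have "c * \<epsilon> / 2 * real (n choose N) \<le> real (card \<W>)" by (simp add: field_simps)
    moreover have "\<delta> * real n ^ N \<le> c * \<epsilon> / 2 * real (n choose N)"
    proof -
      have "\<delta> * real n ^ N = c * \<epsilon> / 2 * (real n / real N) ^ N" by (simp add: \<delta>_def power_divide)
      also have "\<dots> \<le> c * \<epsilon> / 2 * real (n choose N)"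
        using c \<open>\<epsilon> > 0\<close> n binomial_ge_n_over_k_pow_k[of N n] by (intro mult_left_mono) auto
      finally show ?thesis .
    qed
    ultimately have "\<delta> * real n ^ N \<le> real (card \<W>)" by linarith
    moreover have "\<exists>\<tau>. edge_injective_hom (expansion k F\<^sub>0) (edges H) W \<tau>" if "W \<in> \<W>" for W
    proof (rule expansion_hom_into_dense[OF F0 col k])
      show "finite W" using that finite_subset by (auto simp: \<W>_def)
      show "real (p choose r) * (real (card W) / real p) ^ r < real (card (clique_sets k (edges H) r W))"
        using that by (auto simp: \<W>_def M_def)
    qed
    moreover have "\<forall>W\<in>\<W>. W \<subseteq> {..<n} \<and> card W = N" by (auto simp: \<W>_def)
    ultimately have "copies H (expansion k F\<^sub>0) \<noteq> {}" using n0[of n H \<W>] H n by auto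
    with free show False by simp
  qed
  then show ?thesis unfolding eventually_sequentially by (intro exI[of _ "max n0 N"]) blast
qed

section \<open>The Turan hypergraph\<close>

text \<open>
  The vertex \<open>p * a + j\<close> with \<open>j < p\<close> lies in the \<open>j\<close>-th part. Choosing \<open>r\<close> parts \<open>J\<close> and in each of
  them one of its first \<open>n div p\<close> vertices yields different hyperedges for different choices.
\<close>

lemma turan_hypergraph_edges_lower:
  assumes "p > 0"
  shows "(p choose r) * (n div p) ^ r \<le> card (edges (turan_hypergraph r n p))"
proof -
  define X where "X = Sigma {J. J \<subseteq> {..<p} \<and> card J = r} (\<lambda>J. J \<rightarrow>\<^sub>E {..<n div p})"
  define \<Phi> where "\<Phi> = (\<lambda>(J, f). (\<lambda>j. p * f j + j) ` (J :: nat set))"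
  have finJ: "finite J" if "J \<subseteq> {..<p}" for J using that finite_subset by blast
  have "card X = (\<Sum>J\<in>{J. J \<subseteq> {..<p} \<and> card J = r}. card (J \<rightarrow>\<^sub>E {..<n div p}))"
    unfolding X_def by (rule card_SigmaI) (auto simp: finJ finite_PiE)
  also have "\<dots> = (\<Sum>J\<in>{J. J \<subseteq> {..<p} \<and> card J = r}. (n div p) ^ r)"
    by (intro sum.cong refl) (auto simp: card_funcsetE finJ)
  also have "\<dots> = (p choose r) * (n div p) ^ r" using n_subsets[of "{..<p}" r] by simp
  finally have cardX: "card X = (p choose r) * (n div p) ^ r" .
  have mod: "(p * a + j) mod p = j" "(p * a + j) div p = a" if "j < p" for a j
    using that by auto
  have "inj_on \<Phi> X"
  proof (rule inj_onI)
    fix x y assume xy: "x \<in> X" "y \<in> X" "\<Phi> x = \<Phi> y"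
    obtain J f L g where x: "x = (J, f)" and y: "y = (L, g)" by fastforce
    have J: "J \<subseteq> {..<p}" "f \<in> J \<rightarrow>\<^sub>E {..<n div p}" and L: "L \<subseteq> {..<p}" "g \<in> L \<rightarrow>\<^sub>E {..<n div p}"
      using xy x y by (auto simp: X_def)
    have eq: "(\<lambda>j. p * f j + j) ` J = (\<lambda>j. p * g j + j) ` L" using xy x y by (simp add: \<Phi>_def)
    \<comment> \<open>An element of the common image determines its part and its position in it.\<close>
    have sub: "j \<in> L' \<and> f' j = g' j" if "j \<in> J'" "J' \<subseteq> {..<p}" "L' \<subseteq> {..<p}"
        "(\<lambda>j. p * f' j + j) ` J' = (\<lambda>j. p * g' j + j) ` L'" for j J' L' and f' g' :: "nat \<Rightarrow> nat"
    proof -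
      have "p * f' j + j \<in> (\<lambda>j. p * g' j + j) ` L'" using that by blast
      then obtain l where l: "l \<in> L'" "p * f' j + j = p * g' l + l" by blast
      have "j < p" "l < p" using that l by auto
      then have "j = l" "f' j = g' l" using l(2) mod by metis+
      with l show ?thesis by simp
    qed
    have "J = L" using sub[OF _ J(1) L(1) eq] sub[OF _ L(1) J(1) eq[symmetric]] by blast
    moreover have "f = g"
      using sub[OF _ J(1) L(1) eq] J(2) L(2) \<open>J = L\<close> by (intro PiE_ext[of f J _ g]) auto
    ultimately show "x = y" using x y by simp
  qed
  moreover have "\<Phi> ` X \<subseteq> edges (turan_hypergraph r n p)"
  proof
    fix e assume "e \<in> \<Phi> ` X"
    then obtain J f where J: "J \<subseteq> {..<p}" "card J = r" "f \<in> J \<rightarrow>\<^sub>E {..<n div p}"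
      and e: "e = (\<lambda>j. p * f j + j) ` J" by (auto simp: X_def \<Phi>_def)
    have "p * f j + j < n" if "j \<in> J" for j
    proof -
      have "j < p" "f j < n div p" using that J by auto
      then have "p * f j + j < p * Suc (f j)" "p * Suc (f j) \<le> p * (n div p)"
        using mult_le_mono2[of "Suc (f j)" "n div p" p] by auto
      moreover have "p * (n div p) \<le> n" by simp
      ultimately show ?thesis by linarith
    qed
    then have "e \<subseteq> {..<n}" by (auto simp: e)
    moreover have "inj_on (\<lambda>j. p * f j + j) J" using J(1) mod by (intro inj_onI) (metis lessThan_iff subsetD)
    then have "card e = r" using J by (simp add: e card_image)
    moreover have "card (e \<inter> turan_part n p i) \<le> 1" for i
    proof -
      have "x = y" if xy: "x \<in> e \<inter> turan_part n p i" "y \<in> e \<inter> turan_part n p i" for x y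
      proof -
        obtain a b where "a \<in> J" "x = p * f a + a" "b \<in> J" "y = p * f b + b"
          using xy by (auto simp: e)
        moreover have "x mod p = i" "y mod p = i" using xy by (auto simp: turan_part_def)
        moreover have "a < p" "b < p" using J(1) \<open>a \<in> J\<close> \<open>b \<in> J\<close> by auto
        ultimately show ?thesis using mod by metis
      qed
      moreover have "finite (e \<inter> turan_part n p i)" using finJ[OF J(1)] by (simp add: e)
      ultimately show ?thesis by (simp add: card_le_Suc0_iff_eq)
    qed
    ultimately show "e \<in> edges (turan_hypergraph r n p)" by (simp add: turan_hypergraph_def)
  qed
  moreover have "finite (edges (turan_hypergraph r n p))"
    by (rule finite_subset[of _ "Pow {..<n}"]) (auto simp: turan_hypergraph_def)
  ultimately have "card X \<le> card (edges (turan_hypergraph r n p))" by (rule card_inj_on_le)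
  then show ?thesis by (simp add: cardX)
qed

lemma uniform_turan_hypergraph: "uniform_hypergraph k (turan_hypergraph k n p)"
  by (auto simp: uniform_hypergraph_def hypergraph_def turan_hypergraph_def)

lemma turan_edge_mod_inj:
  assumes "e \<in> edges (turan_hypergraph k n p)" "p > 0" "x \<in> e" "y \<in> e" "x mod p = y mod p"
  shows "x = y"
proof -
  have e: "e \<subseteq> {..<n}" "\<And>i. i < p \<Longrightarrow> card (e \<inter> turan_part n p i) \<le> 1"
    using assms(1) by (auto simp: turan_hypergraph_def)
  have "finite (e \<inter> turan_part n p (x mod p))" using e(1) finite_subset by blast
  moreover have "card (e \<inter> turan_part n p (x mod p)) \<le> 1" using e(2) assms by simp
  moreover have "{x, y} \<subseteq> e \<inter> turan_part n p (x mod p)"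
    using assms e(1) by (auto simp: turan_part_def)
  ultimately show ?thesis by (auto simp: card_le_Suc0_iff_eq)
qed

text \<open>
  Colour each vertex of \<open>F\<^sub>0\<close> by the part containing its image in a supposed copy. The ends of an edge
  of \<open>F\<^sub>0\<close> lie in a common hyperedge, which meets every part at most once.
\<close>

lemma turan_hypergraph_expansion_free:
  fixes F\<^sub>0 :: "'a hypergraph"
  assumes F0: "simple_graph F\<^sub>0" and "p > 0" and uncol: "\<And>f. \<not> proper_coloring F\<^sub>0 p f"
  shows "copies (turan_hypergraph k n p) (expansion k F\<^sub>0) = {}"
proof (rule ccontr)
  let ?T = "turan_hypergraph k n p" and ?F = "expansion k F\<^sub>0"
  assume "copies ?T ?F \<noteq> {}"
  then obtain S f where S: "hypergraph S" "edges S \<subseteq> edges ?T"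
    and f: "bij_betw f (verts S) (verts ?F)" "(`) f ` edges S = edges ?F"
    by (auto simp: copies_def subhypergraph_def isomorphic_def)
  define g where "g v = the_inv_into (verts S) f (Inl v)" for v
  have "proper_coloring F\<^sub>0 p (\<lambda>v. g v mod p)"
    unfolding proper_coloring_def
  proof (intro conjI allI impI)
    show "(\<lambda>v. g v mod p) ` verts F\<^sub>0 \<subseteq> {..<p}" using \<open>p > 0\<close> by auto
    fix u v assume uv: "{u, v} \<in> edges F\<^sub>0"
    then have "card {u, v} = 2" using F0 unfolding uniform_hypergraph_def by blast
    then have "u \<noteq> v" by auto
    have "expansion_edge k {u, v} \<in> (`) f ` edges S" using uv f(2) by (simp add: expansion_def)
    then obtain e where e: "e \<in> edges S" "f ` e = expansion_edge k {u, v}" by auto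
    have sub: "e \<subseteq> verts S" using S e by (auto simp: hypergraph_def)
    have g: "g w \<in> e \<and> f (g w) = Inl w" if "w \<in> {u, v}" for w
    proof -
      have "Inl w \<in> f ` e" using that e by (auto simp: expansion_edge_def)
      then obtain x where "x \<in> e" "f x = Inl w" by auto
      moreover from this have "g w = x"
        using f(1) sub by (metis bij_betw_def g_def subsetD the_inv_into_f_f)
      ultimately show ?thesis by simp
    qed
    then have "g u \<noteq> g v" using \<open>u \<noteq> v\<close> by (metis insertI1 insertI2 sum.inject(1))
    then show "g u mod p \<noteq> g v mod p"
      using turan_edge_mod_inj[of e k n p "g u" "g v"] g e S \<open>p > 0\<close> by auto
  qed
  with uncol show False by blast
qed

lemma turan_edges_are_cliques:
  "edges (turan_hypergraph r n p) \<subseteq> clique_sets k (edges (turan_hypergraph k n p)) r {..<n}"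
proof
  fix A assume "A \<in> edges (turan_hypergraph r n p)"
  then have A: "A \<subseteq> {..<n}" "card A = r" "\<And>i. i < p \<Longrightarrow> card (A \<inter> turan_part n p i) \<le> 1"
    by (auto simp: turan_hypergraph_def)
  have "card (e \<inter> turan_part n p i) \<le> 1" if "e \<subseteq> A" "i < p" for e i
  proof -
    have "finite A" using A(1) finite_subset by blast
    then have "card (e \<inter> turan_part n p i) \<le> card (A \<inter> turan_part n p i)"
      using that by (intro card_mono) auto
    with A(3)[OF that(2)] show ?thesis by linarith
  qed
  then show "A \<in> clique_sets k (edges (turan_hypergraph k n p)) r {..<n}"
    using A by (auto simp: clique_sets_def turan_hypergraph_def)
qed

text \<open>
  A finite simple graph has a proper colouring, by distinct colours, so the least element defining
  the chromatic number exists.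
\<close>

lemma chromatic_number_coloring:
  assumes "simple_graph G"
  shows "\<exists>f. proper_coloring G (chromatic_number G) f"
proof -
  have "finite (verts G)" using assms by (simp add: uniform_hypergraph_def hypergraph_def)
  then obtain f n where f: "inj_on f (verts G)" "f ` verts G = {i::nat. i < n}"
    using finite_imp_inj_to_nat_seg by metis
  have "proper_coloring G n f"
    unfolding proper_coloring_def
  proof (intro conjI allI impI)
    fix u v assume uv: "{u, v} \<in> edges G"
    then have "card {u, v} = 2" "{u, v} \<subseteq> verts G"
      using assms unfolding uniform_hypergraph_def hypergraph_def by blast+
    then show "f u \<noteq> f v" using f(1) by (cases "u = v") (auto dest: inj_onD)
  qed (use f in auto)
  then show ?thesis unfolding chromatic_number_def by (rule_tac LeastI_ex) blast
qed

section \<open>Asymptotics\<close>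

text \<open>
  The maximum defining \<open>ex\<close> is over a finite set, as the counts are at most \<open>2 ^ n\<close>. The hypergraph
  \<open>T\<close> witnesses that the set is nonempty, so the maximum is attained.
\<close>

lemma ex_bounds:
  fixes F :: "'x hypergraph"
  assumes T: "uniform_hypergraph k T" "verts T = {..<n}" "copies T F = {}"
  shows "card (clique_sets k (edges T) r {..<n}) \<le> ex k n (complete_hypergraph k r) F"
    and "\<exists>H. uniform_hypergraph k H \<and> verts H = {..<n} \<and> copies H F = {} \<and>
      ex k n (complete_hypergraph k r) F = card (clique_sets k (edges H) r {..<n})"
proof -
  let ?K = "complete_hypergraph k r"
  let ?X = "{card (copies H ?K) | H :: nat hypergraph.
            uniform_hypergraph k H \<and> verts H = {..<n} \<and> copies H F = {}}"
  have eq: "card (copies H ?K) = card (clique_sets k (edges H) r {..<n})"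
    if "uniform_hypergraph k H" "verts H = {..<n}" for H
    using card_copies_complete_hypergraph[OF that(1)] that(2) by simp
  have "card (clique_sets k E r {..<n}) \<le> 2 ^ n" for E :: "nat set set"
    using card_mono[of "Pow {..<n}" "clique_sets k E r {..<n}"]
    by (auto simp: card_Pow clique_sets_def)
  then have "?X \<subseteq> {..2 ^ n}" using eq by auto
  then have fin: "finite ?X" using finite_subset by blast
  have T_in: "card (copies T ?K) \<in> ?X" using T by blast
  show "card (clique_sets k (edges T) r {..<n}) \<le> ex k n ?K F"
    using Max_ge[OF fin T_in] eq T by (simp add: ex_def)
  have "ex k n ?K F \<in> ?X" unfolding ex_def using Max_in[OF fin] T_in by blast
  then show "\<exists>H. uniform_hypergraph k H \<and> verts H = {..<n} \<and> copies H F = {} \<and>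
      ex k n ?K F = card (clique_sets k (edges H) r {..<n})"
    using eq by auto
qed

theorem corollary20:
  fixes F\<^sub>0 :: "'a hypergraph" and k r m :: nat
  assumes "simple_graph F\<^sub>0"
    and "k \<ge> 2"
    and "m = chromatic_number F\<^sub>0"
    and "m > r" and "r > k"
  shows "(\<lambda>n. real (ex k n (complete_hypergraph k r) (expansion k F\<^sub>0)))
           \<sim>[at_top] (\<lambda>n. real (card (edges (turan_hypergraph r n (m - 1)))))"
proof -
  define p where "p = m - 1"
  have p: "m = Suc p" "r \<le> p" "p > 0" "k \<le> r" using assms by (auto simp: p_def)
  define x where "x n = real (ex k n (complete_hypergraph k r) (expansion k F\<^sub>0))" for n
  define t where "t n = real (card (edges (turan_hypergraph r n p)))" for n
  define M where "M n = real (p choose r) * (real n / real p) ^ r" for n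
  obtain f where col: "proper_coloring F\<^sub>0 (Suc p) f"
    using chromatic_number_coloring[OF assms(1)] assms(3) p by auto
  have uncol: "\<not> proper_coloring F\<^sub>0 p f" for f
    using not_less_Least[of p "\<lambda>c. \<exists>f. proper_coloring F\<^sub>0 c f"] assms(3) p
    unfolding chromatic_number_def by auto
  have T: "uniform_hypergraph k (turan_hypergraph k n p)" "verts (turan_hypergraph k n p) = {..<n}"
      "copies (turan_hypergraph k n p) (expansion k F\<^sub>0) = {}" for n
    using uniform_turan_hypergraph turan_hypergraph_expansion_free[OF assms(1) \<open>p > 0\<close> uncol]
    by (auto simp: turan_hypergraph_def)
  have t_le_x: "t n \<le> x n" for n
  proof -
    have "card (edges (turan_hypergraph r n p))
        \<le> card (clique_sets k (edges (turan_hypergraph k n p)) r {..<n})"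
      by (intro card_mono turan_edges_are_cliques finite_clique_sets) simp
    also have "\<dots> \<le> ex k n (complete_hypergraph k r) (expansion k F\<^sub>0)" by (rule ex_bounds(1)[OF T])
    finally show ?thesis by (simp add: t_def x_def)
  qed
  have M_le_t: "M n * (1 - real p / real n) ^ r \<le> t n" if n: "n \<ge> p" for n
  proof -
    have "real n / real p * (1 - real p / real n) = real n / real p - 1"
      using p n by (simp add: field_simps)
    also have "\<dots> \<le> real (n div p)"
    proof -
      have "n \<le> p * (n div p + 1)" using dividend_less_times_div[of p n] p by simp
      then have "real n \<le> real p * (real (n div p) + 1)"
        by (metis of_nat_1 of_nat_add of_nat_le_iff of_nat_mult)
      then have "real n / real p \<le> real (n div p) + 1"
        using p by (subst pos_divide_le_eq) (simp_all add: mult.commute)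
      then show ?thesis by linarith
    qed
    finally have le: "(real n / real p * (1 - real p / real n)) ^ r \<le> real (n div p) ^ r"
      using n p by (intro power_mono mult_nonneg_nonneg) (auto simp: field_simps)
    have "M n * (1 - real p / real n) ^ r
        = real (p choose r) * (real n / real p * (1 - real p / real n)) ^ r"
      by (simp only: M_def power_mult_distrib mult.assoc)
    also have "\<dots> \<le> real (p choose r) * real (n div p) ^ r"
      using le by (rule mult_left_mono) simp
    also have "\<dots> = real ((p choose r) * (n div p) ^ r)" by simp
    also have "\<dots> \<le> t n"
      unfolding t_def by (intro of_nat_mono turan_hypergraph_edges_lower p)
    finally show ?thesis .
  qed
  \<comment> \<open>Eventually \<open>M n * (1 - p / n) ^ r \<le> t n \<le> x n \<le> (1 + \<epsilon>) * M n\<close>.\<close>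
  have "((\<lambda>n. x n / t n) \<longlongrightarrow> 1) sequentially"
  proof (rule order_tendstoI)
    fix a :: real assume "a < 1"
    have "\<forall>\<^sub>F n in sequentially. 0 < (1 - real p / real n) ^ r"
      using power_ratio_tendsto_1 by (rule order_tendstoD(1)) simp
    then show "\<forall>\<^sub>F n in sequentially. a < x n / t n"
      using eventually_ge_at_top[of p]
    proof eventually_elim
      case (elim n)
      then have "M n > 0" using p by (simp add: M_def)
      then have "0 < M n * (1 - real p / real n) ^ r" using elim by simp
      with M_le_t[OF elim(2)] have "t n > 0" by linarith
      then have "1 \<le> x n / t n" using t_le_x[of n] by simp
      with \<open>a < 1\<close> show ?case by linarith
    qed
  next
    fix a :: real assume "1 < a"
    define \<epsilon> where "\<epsilon> = (a - 1) / 2"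
    have "a = 1 + 2 * \<epsilon>" by (simp add: \<epsilon>_def field_simps)
    then have \<epsilon>: "\<epsilon> > 0" "1 + \<epsilon> < a" using \<open>1 < a\<close> by simp_all
    have "(1 + \<epsilon>) / a < 1" using \<epsilon> \<open>1 < a\<close> by (simp add: pos_divide_less_eq)
    then have "\<forall>\<^sub>F n in sequentially. (1 + \<epsilon>) / a < (1 - real p / real n) ^ r"
      using power_ratio_tendsto_1 order_tendstoD(1) by blast
    then show "\<forall>\<^sub>F n in sequentially. x n / t n < a"
      using eventually_ge_at_top[of p]
        clique_sets_upper_bound[OF assms(1) col assms(2) p(4) p(2) \<epsilon>(1)]
    proof eventually_elim
      case (elim n)
      obtain H where H: "uniform_hypergraph k H" "verts H = {..<n}" "copies H (expansion k F\<^sub>0) = {}"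
        "x n = real (card (clique_sets k (edges H) r {..<n}))"
        using ex_bounds(2)[OF T[of n], of r] unfolding x_def by metis
      have x_le: "x n \<le> (1 + \<epsilon>) * M n"
        unfolding H(4) M_def using elim(3) H(1-3) by blast
      have "M n > 0" using p elim(2) by (simp add: M_def)
      moreover have "1 + \<epsilon> < a * (1 - real p / real n) ^ r"
        using elim(1) \<open>1 < a\<close> by (simp add: pos_divide_less_eq mult.commute)
      ultimately have "M n * (1 + \<epsilon>) < M n * (a * (1 - real p / real n) ^ r)"
        by (intro mult_strict_left_mono)
      then have "(1 + \<epsilon>) * M n < a * (M n * (1 - real p / real n) ^ r)"
        by (simp only: mult_ac)
      also have "\<dots> \<le> a * t n" using M_le_t[OF elim(2)] \<open>1 < a\<close> by (intro mult_left_mono) auto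
      finally have "x n < a * t n" using x_le by linarith
      moreover have "t n > 0"
      proof -
        have "0 \<le> x n" by (simp add: x_def)
        with \<open>x n < a * t n\<close> have "0 < a * t n" by linarith
        then show ?thesis using \<open>1 < a\<close> by (simp add: zero_less_mult_iff)
      qed
      ultimately show ?case by (simp add: pos_divide_less_eq)
    qed
  qed
  then have "x \<sim>[at_top] t" by (intro asymp_equivI')
  then show ?thesis unfolding x_def t_def p_def .
qed

end
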